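(* Let $f\in L^2(\Omega)$ and let $\alpha\in \mathrm{M}^+(\Omega)$ be a nonnegative Borel measure. Then there exists a unique solution in $\mathrm{BV}_{\Gamma_D}(\Omega)$ to the problem $$\min\ \frac12\int_\Omega |u(x)|^2\,dx-\int_\Omega f(x)u(x)\,dx\quad\text{over } u\in \mathrm{BV}_{\Gamma_D}(\Omega),\qquad\text{subject to } u\in K,$$ where $K=\{v\in \mathrm{BV}_{\Gamma_D}(\Omega): |\mathrm{D}v|_p\le \alpha\}$.
   Context: $\Omega\subset\mathbb{R}^{\mathrm d}$ is a bounded domain with Lipschitz boundary. The boundary $\partial\Omega$ is partitioned into $\Gamma_D$ and $\Gamma_N$, each composed of a finite number of connected parts, with $\overline{\Gamma}_D\cup\overline{\Gamma}_N=\partial\Omega$ and $\Gamma_D\cap\Gamma_N=\emptyset$. The exponent $p$ satisfies $1\le p\le+\infty$. $\mathrm{M}(\Omega)$ is the space of real-valued (finite) Borel measures on $\Omega$, and $\mathrm{M}^+(\Omega)$ its subset of nonnegative measures. $\mathrm{BV}(\Omega)$ is the space of functions of bounded variation, $\mathrm{D}v$ is the distributional gradient ($\mathbb{R}^{\mathrm d}$-valued Borel measure) of $v\in \mathrm{BV}(\Omega)$, and $|\mathrm{D}v|_p$ is its total variation measure associated with the $\ell^p$-norm: for open $O\subset\Omega$, $|\mathrm{D}v|_p(O)=\sup\{\int_O v\,\mathrm{div}\,\mathbf{w}\,dx:\mathbf{w}\in C_0^1(O)^{\mathrm d},\ |\mathbf{w}(x)|_q\le1\ \forall x\}$ with $1/p+1/q=1$.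 $\mathrm{BV}_{\Gamma_D}(\Omega)=\{v\in \mathrm{BV}(\Omega):\gamma_0(v)=0\text{ on }\Gamma_D\}$, where $\gamma_0:\mathrm{BV}(\Omega)\to L^1(\partial\Omega)$ is the trace operator. The inequality $|\mathrm{D}v|_p\le\alpha$ is in the sense of measures, i.e. $|\mathrm{D}v|_p(S)\le\alpha(S)$ for every Borel set $S\subset\Omega$. The objective is understood as $+\infty$ if $u\notin L^2(\Omega)$. *)

theory Defs
  imports "HOL-Analysis.Analysis"
begin

text \<open>Functions on \<open>\<Omega>\<close> are represented by total functions on \<^typ>\<open>real^'n\<close>, whose values outside
  \<open>\<Omega>\<close> play no role. Elements of \<open>L\<^sup>1(\<Omega>)\<close>, \<open>L\<^sup>2(\<Omega>)\<close> and \<open>BV(\<Omega>)\<close> are given by representatives, and all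
  the notions below are invariant under changes on Lebesgue null sets.\<close>

subsection \<open>Bounded Lipschitz domains\<close>

text \<open>Locally, in an orthonormal coordinate system with vertical direction \<open>e\<close>, \<open>\<Omega>\<close> is the strict
  supergraph of a Lipschitz function \<open>g\<close> on the hyperplane orthogonal to \<open>e\<close>; the horizontal part of
  \<open>y\<close> is \<open>y - (y \<bullet> e) *\<^sub>R e\<close>.\<close>

definition lipschitz_boundary :: "(real^'n) set \<Rightarrow> bool" where
  "lipschitz_boundary \<Omega> \<longleftrightarrow>
     (\<forall>x\<in>frontier \<Omega>. \<exists>e g L r. norm e = 1 \<and> L-lipschitz_on {z. z \<bullet> e = 0} g \<and> r > 0 \<and>
        \<Omega> \<inter> ball x r = {y \<in> ball x r. g (y - (y \<bullet> e) *\<^sub>R e) < y \<bullet> e})"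

definition bounded_lipschitz_domain :: "(real^'n) set \<Rightarrow> bool" where
  "bounded_lipschitz_domain \<Omega> \<longleftrightarrow>
     open \<Omega> \<and> connected \<Omega> \<and> \<Omega> \<noteq> {} \<and> bounded \<Omega> \<and> lipschitz_boundary \<Omega>"

definition boundary_partition ::
    "(real^'n) set \<Rightarrow> (real^'n) set \<Rightarrow> (real^'n) set \<Rightarrow> bool" where
  "boundary_partition \<Omega> \<Gamma>D \<Gamma>N \<longleftrightarrow>
     \<Gamma>D \<subseteq> frontier \<Omega> \<and> \<Gamma>N \<subseteq> frontier \<Omega> \<and>
     finite (components \<Gamma>D) \<and> finite (components \<Gamma>N) \<and>
     closure \<Gamma>D \<union> closure \<Gamma>N = frontier \<Omega> \<and> \<Gamma>D \<inter> \<Gamma>N = {}"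

subsection \<open>Variation with respect to an \<open>\<ell>\<^sup>p\<close>-norm\<close>

definition lp_norm :: "ennreal \<Rightarrow> real^'n \<Rightarrow> real" where
  "lp_norm p x = (if p = \<infinity> then infnorm x
     else (\<Sum>i\<in>UNIV. \<bar>x $ i\<bar> powr enn2real p) powr (1 / enn2real p))"

text \<open>In \<^typ>\<open>ennreal\<close> one has \<open>1 / 0 = \<infinity>\<close> and \<open>1 / \<infinity> = 0\<close>, so the cases \<open>p = 1\<close> and \<open>p = \<infinity>\<close> are included.\<close>

definition conjugate_exponent :: "ennreal \<Rightarrow> ennreal" where
  "conjugate_exponent p = 1 / (1 - 1 / p)"

lemma conjugate_exponent:
  assumes "1 \<le> p"
  shows "1 / p + 1 / conjugate_exponent p = 1"
proof -
  have inv_inv: "1 / (1 / y) = y" for y :: ennreal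
  proof (cases y)
    case (real r)
    then show ?thesis
      by (cases "r = 0") (simp_all add: divide_ennreal_def inverse_ennreal)
  qed (simp add: divide_ennreal_def)
  have "1 / p \<le> 1"
  proof (cases p)
    case (real r)
    then have "1 \<le> r" using assms by simp
    then have "1 / p = ennreal (1 / r)"
      using real by (simp add: divide_ennreal flip: ennreal_1)
    then show ?thesis using \<open>1 \<le> r\<close> by simp
  qed simp
  then show ?thesis
    by (simp add: conjugate_exponent_def inv_inv)
qed

definition divergence :: "(real^'n \<Rightarrow> real^'n) \<Rightarrow> real^'n \<Rightarrow> real" where
  "divergence w x = (\<Sum>i\<in>UNIV. frechet_derivative w (at x) (axis i 1) $ i)"

text \<open>\<open>C\<^sub>0\<^sup>1(O)\<^sup>d\<close>: continuously differentiable vector fields with compact support in \<open>O\<close>,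
  extended by zero.\<close>

definition C1_compact_support :: "(real^'n) set \<Rightarrow> (real^'n \<Rightarrow> real^'n) set" where
  "C1_compact_support S =
     {w. (\<forall>x. w differentiable (at x)) \<and>
         (\<forall>h. continuous_on UNIV (\<lambda>x. frechet_derivative w (at x) h)) \<and>
         compact (closure {x. w x \<noteq> 0}) \<and> closure {x. w x \<noteq> 0} \<subseteq> S}"

text \<open>\<^const>\<open>ennreal\<close> truncates negative numbers to \<open>0\<close>, which does not affect the supremum, since
  \<open>w = 0\<close> is admissible.\<close>

definition variation_open :: "ennreal \<Rightarrow> (real^'n \<Rightarrow> real) \<Rightarrow> (real^'n) set \<Rightarrow> ennreal" where
  "variation_open p v U =
     (SUP w\<in>{w \<in> C1_compact_support U. \<forall>x. lp_norm (conjugate_exponent p) (w x) \<le> 1}.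
        ennreal (LINT x:U|lebesgue. v x * divergence w x))"

text \<open>\<open>|Dv|\<^sub>p(S)\<close> for Borel \<open>S \<subseteq> \<Omega>\<close>: the outer regular extension of the values on open sets. As finite
  Borel measures on \<open>\<Omega>\<close> are outer regular, for \<open>v \<in> BV(\<Omega>)\<close> this is the only Borel measure on \<open>\<Omega>\<close>
  with the prescribed values on open sets.\<close>

definition variation :: "ennreal \<Rightarrow> (real^'n) set \<Rightarrow> (real^'n \<Rightarrow> real) \<Rightarrow> (real^'n) set \<Rightarrow> ennreal" where
  "variation p \<Omega> v S = (INF U\<in>{U. open U \<and> S \<subseteq> U \<and> U \<subseteq> \<Omega>}. variation_open p v U)"

lemma divergence_eq_0:
  assumes "x \<notin> closure {x. w x \<noteq> 0}"
  shows "divergence w x = 0"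
proof -
  have "(w has_derivative (\<lambda>h. 0)) (at x)"
  proof (rule has_derivative_transform_within_open)
    show "((\<lambda>x. 0) has_derivative (\<lambda>h. 0)) (at x)" by simp
    show "open (- closure {x. w x \<noteq> 0})" by blast
    show "x \<in> - closure {x. w x \<noteq> 0}" using assms by simp
    show "0 = w y" if "y \<in> - closure {x. w x \<noteq> 0}" for y
      using that closure_subset[of "{x. w x \<noteq> 0}"] by auto
  qed
  then have "frechet_derivative w (at x) = (\<lambda>h. 0)"
    using frechet_derivative_at by metis
  then show ?thesis by (simp add: divergence_def)
qed

lemma variation_open_mono:
  assumes "U \<subseteq> V"
  shows "variation_open p v U \<le> variation_open p v V"
  unfolding variation_open_def
proof (rule SUP_mono)
  fix w assume w: "w \<in> {w \<in> C1_compact_support U. \<forall>x. lp_norm (conjugate_exponent p) (w x) \<le> 1}"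
  then have supp: "closure {x. w x \<noteq> 0} \<subseteq> U"
    by (simp add: C1_compact_support_def)
  have eq: "indicat_real U x *\<^sub>R (v x * divergence w x) = indicat_real V x *\<^sub>R (v x * divergence w x)" for x
  proof (cases "x \<in> U")
    case True
    then show ?thesis using assms by auto
  next
    case False
    then have "divergence w x = 0" using supp by (intro divergence_eq_0) auto
    then show ?thesis by simp
  qed
  have "(LINT x:U|lebesgue. v x * divergence w x) = (LINT x:V|lebesgue. v x * divergence w x)"
    unfolding set_lebesgue_integral_def eq ..
  moreover have "w \<in> {w \<in> C1_compact_support V. \<forall>x. lp_norm (conjugate_exponent p) (w x) \<le> 1}"
    using w assms by (auto simp: C1_compact_support_def)
  ultimately show "\<exists>w'\<in>{w \<in> C1_compact_support V. \<forall>x. lp_norm (conjugate_exponent p) (w x) \<le> 1}.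
      ennreal (LINT x:U|lebesgue. v x * divergence w x)
        \<le> ennreal (LINT x:V|lebesgue. v x * divergence w' x)"
    by (intro bexI[of _ w]) auto
qed

lemma variation_eq_variation_open:
  assumes "open U" "U \<subseteq> \<Omega>"
  shows "variation p \<Omega> v U = variation_open p v U"
  unfolding variation_def
  using assms by (intro antisym INF_lower INF_greatest) (auto intro: variation_open_mono)

definition BV :: "(real^'n) set \<Rightarrow> (real^'n \<Rightarrow> real) set" where
  "BV \<Omega> = {v. integrable (lebesgue_on \<Omega>) v \<and> variation 2 \<Omega> v \<Omega> < \<infinity>}"

subsection \<open>Boundary traces\<close>

text \<open>The \<open>k\<close>-dimensional Hausdorff outer measure. Empty sets in a covering are not counted, which
  matters for \<open>k = 0\<close>; boundedness is required since \<^const>\<open>diameter\<close> is meaningless otherwise.\<close>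

definition hausdorff_measure :: "nat \<Rightarrow> 'a::metric_space set \<Rightarrow> ennreal" where
  "hausdorff_measure k A =
     (SUP \<delta>\<in>{0<..}.
        INF C\<in>{C :: nat \<Rightarrow> 'a set. A \<subseteq> (\<Union>i. C i) \<and> (\<forall>i. bounded (C i) \<and> diameter (C i) \<le> \<delta>)}.
          \<Sum>i. if C i = {} then 0
              else ennreal (unit_ball_vol (real k) * (diameter (C i) / 2) ^ k))"

text \<open>\<open>has_trace_at \<Omega> v x t\<close> means \<open>\<gamma>\<^sub>0(v)(x) = t\<close>. For a bounded Lipschitz domain \<open>\<Omega>\<close> and \<open>v \<in> BV(\<Omega>)\<close>,
  the boundary trace theorem provides such a \<open>t\<close>, necessarily unique, for almost every \<open>x \<in> \<partial>\<Omega>\<close> with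
  respect to the \<open>(d-1)\<close>-dimensional Hausdorff measure, and \<open>\<gamma>\<^sub>0(v)\<close> is the resulting function
  (Ambrosio, Fusco, Pallara, Functions of Bounded Variation and Free Discontinuity Problems,
  Theorem 3.87).\<close>

definition has_trace_at :: "(real^'n) set \<Rightarrow> (real^'n \<Rightarrow> real) \<Rightarrow> real^'n \<Rightarrow> real \<Rightarrow> bool" where
  "has_trace_at \<Omega> v x t \<longleftrightarrow>
     ((\<lambda>r. (LINT y:\<Omega> \<inter> ball x r|lebesgue. \<bar>v y - t\<bar>) / r ^ CARD('n)) \<longlongrightarrow> 0) (at_right 0)"

definition BV_zero_trace :: "(real^'n) set \<Rightarrow> (real^'n) set \<Rightarrow> (real^'n \<Rightarrow> real) set" where
  "BV_zero_trace \<Omega> \<Gamma>D =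
     {v \<in> BV \<Omega>. \<exists>N. hausdorff_measure (CARD('n) - 1) N = 0 \<and>
                    (\<forall>x\<in>\<Gamma>D - N. has_trace_at \<Omega> v x 0)}"

subsection \<open>The constrained minimization problem\<close>

definition L2 :: "(real^'n) set \<Rightarrow> (real^'n \<Rightarrow> real) set" where
  "L2 \<Omega> = {v \<in> borel_measurable (lebesgue_on \<Omega>). integrable (lebesgue_on \<Omega>) (\<lambda>x. (v x)\<^sup>2)}"

definition nonneg_borel_measure :: "(real^'n) set \<Rightarrow> (real^'n) measure \<Rightarrow> bool" where
  "nonneg_borel_measure \<Omega> \<alpha> \<longleftrightarrow> sets \<alpha> = sets (restrict_space borel \<Omega>) \<and> finite_measure \<alpha>"

definition constraint_set ::
    "ennreal \<Rightarrow> (real^'n) set \<Rightarrow> (real^'n) set \<Rightarrow> (real^'n) measure \<Rightarrow> (real^'n \<Rightarrow> real) set" where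
  "constraint_set p \<Omega> \<Gamma>D \<alpha> =
     {v \<in> BV_zero_trace \<Omega> \<Gamma>D. \<forall>S\<in>sets borel. S \<subseteq> \<Omega> \<longrightarrow> variation p \<Omega> v S \<le> emeasure \<alpha> S}"

definition objective :: "(real^'n) set \<Rightarrow> (real^'n \<Rightarrow> real) \<Rightarrow> (real^'n \<Rightarrow> real) \<Rightarrow> ereal" where
  "objective \<Omega> f u =
     (if u \<in> L2 \<Omega>
      then ereal (1/2 * (LINT x|lebesgue_on \<Omega>. \<bar>u x\<bar>\<^sup>2) - (LINT x|lebesgue_on \<Omega>. f x * u x))
      else \<infinity>)"

definition is_solution ::
    "ennreal \<Rightarrow> (real^'n) set \<Rightarrow> (real^'n) set \<Rightarrow> (real^'n \<Rightarrow> real) \<Rightarrow> (real^'n) measure \<Rightarrow>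
     (real^'n \<Rightarrow> real) \<Rightarrow> bool" where
  "is_solution p \<Omega> \<Gamma>D f \<alpha> u \<longleftrightarrow>
     is_arg_min (objective \<Omega> f) (\<lambda>v. v \<in> constraint_set p \<Omega> \<Gamma>D \<alpha>) u"

end

theory Submission
  imports Defs
begin

text \<open>The objective is, up to a constant, half the squared \<open>L\<^sup>2\<close> distance to \<open>f\<close>, so by the parallelogram
  identity a minimizing sequence in the convex set \<open>K\<close> is Cauchy, and minimizers are unique. The point is
  that \<open>K\<close> is closed under \<open>L\<^sup>1\<close> convergence. The variation bound is a family of linear inequalities,
  one for every open set and test field, and each of them passes to the limit.

  The vanishing trace passes to the limit since \<open>\<alpha>\<close> is a finite measure on the open set \<open>\<Omega>\<close> and hence
  gives small mass to thin strips along the boundary. In a Lipschitz chart with vertical direction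
  \<open>e\<close>, testing with \<open>\<psi> e\<close>, where \<open>\<psi>\<close> integrates a smoothed indicator of \<open>{w > 0}\<close> or \<open>{w < 0}\<close> along vertical segments, bounds the
  integral of \<open>\<bar>w\<bar>\<close> over \<open>\<Omega> \<inter> B(x, r)\<close> by its integral over a vertical translate plus \<open>r\<close> times the variation in the column
  above \<open>B(x, r)\<close>. Averaging over disjoint translates up to height \<open>T\<close> and applying Vitali's covering
  lemma to the projected balls, the \<open>(d-1)\<close>-dimensional Hausdorff content of the set of boundary points where
  \<open>r\<^sup>-\<^sup>d \<integral>\<bar>w\<bar>\<close> exceeds \<open>\<epsilon>\<close> at arbitrarily small scales is at most
  \<open>C/\<epsilon>\<close> times \<open>\<parallel>w\<parallel>\<^sub>1/T\<close> plus the variation of \<open>w\<close> in the strip of width \<open>2T\<close>. This is applied to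
  \<open>w = u - u\<^sub>n\<close>, letting first \<open>n \<rightarrow> \<infinity>\<close> and then \<open>T \<rightarrow> 0\<close>.\<close>

subsection \<open>Hausdorff null sets\<close>

definition cover_weight :: "nat \<Rightarrow> 'a::metric_space set \<Rightarrow> ennreal" where
  "cover_weight k S =
     (if S = {} then 0 else ennreal (unit_ball_vol (real k) * (diameter S / 2) ^ k))"

text \<open>A supremum of infima vanishes exactly when every infimum does, and an infimum vanishes
  exactly when some cover beats each \<epsilon>. Null sets are handled through this criterion
  alone.\<close>

lemma hausdorff_measure_eq_0_iff:
  fixes A :: "'a::metric_space set"
  shows "hausdorff_measure k A = 0 \<longleftrightarrow>
     (\<forall>\<delta>>0. \<forall>\<epsilon>>0. \<exists>C :: nat \<Rightarrow> 'a set. A \<subseteq> (\<Union>i. C i) \<and>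
        (\<forall>i. bounded (C i) \<and> diameter (C i) \<le> \<delta>) \<and> (\<Sum>i. cover_weight k (C i)) \<le> ennreal \<epsilon>)"
    (is "_ \<longleftrightarrow> (\<forall>\<delta>>0. \<forall>\<epsilon>>0. ?P \<delta> \<epsilon>)")
proof -
  define I where "I \<delta> = (INF C\<in>{C :: nat \<Rightarrow> 'a set. A \<subseteq> (\<Union>i. C i) \<and> (\<forall>i. bounded (C i) \<and> diameter (C i) \<le> \<delta>)}.
      \<Sum>i. cover_weight k (C i))" for \<delta>
  have h: "hausdorff_measure k A = (SUP \<delta>\<in>{0<..}. I \<delta>)"
    unfolding hausdorff_measure_def I_def cover_weight_def ..
  show ?thesis
  proof (intro iffI allI impI)
    fix \<delta> \<epsilon> :: real assume 0: "hausdorff_measure k A = 0" and "0 < \<delta>" "0 < \<epsilon>"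
    then have "I \<delta> \<le> 0" unfolding 0[symmetric] h by (intro SUP_upper) simp
    then have "I \<delta> < ennreal \<epsilon>" using \<open>0 < \<epsilon>\<close> by simp
    then obtain C where "C \<in> {C :: nat \<Rightarrow> 'a set. A \<subseteq> (\<Union>i. C i) \<and> (\<forall>i. bounded (C i) \<and> diameter (C i) \<le> \<delta>)}"
      "(\<Sum>i. cover_weight k (C i)) < ennreal \<epsilon>"
      unfolding I_def INF_less_iff by blast
    then show "?P \<delta> \<epsilon>" using less_imp_le by blast
  next
    assume P: "\<forall>\<delta>>0. \<forall>\<epsilon>>0. ?P \<delta> \<epsilon>"
    have "I \<delta> \<le> 0" if "\<delta> > 0" for \<delta>
    proof (rule ennreal_le_epsilon)
      fix \<epsilon> :: real assume "0 < \<epsilon>"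
      then obtain C :: "nat \<Rightarrow> 'a set" where C: "A \<subseteq> (\<Union>i. C i)"
          "\<forall>i. bounded (C i) \<and> diameter (C i) \<le> \<delta>" "(\<Sum>i. cover_weight k (C i)) \<le> ennreal \<epsilon>"
        using P \<open>\<delta> > 0\<close> by blast
      have "I \<delta> \<le> (\<Sum>i. cover_weight k (C i))"
        unfolding I_def using C(1,2) by (intro INF_lower) blast
      with C(3) show "I \<delta> \<le> 0 + ennreal \<epsilon>" by simp
    qed
    then have "hausdorff_measure k A \<le> 0" unfolding h by (intro SUP_least) simp
    then show "hausdorff_measure k A = 0" by simp
  qed
qed

lemma hausdorff_measure_0_subset:
  fixes A B :: "'a::metric_space set"
  assumes "hausdorff_measure k B = 0" "A \<subseteq> B"
  shows "hausdorff_measure k A = 0"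
  using assms(1) unfolding hausdorff_measure_eq_0_iff by (meson assms(2) order_trans)

text \<open>The \<open>n\<close>-th set gets a cover of weight at most \<epsilon> / 2^(n+1), and the
  double family of covers is enumerated through \<open>prod_decode\<close>.\<close>

lemma hausdorff_measure_0_UN:
  fixes A :: "nat \<Rightarrow> 'a::metric_space set"
  assumes "\<And>n. hausdorff_measure k (A n) = 0"
  shows "hausdorff_measure k (\<Union>n. A n) = 0"
  unfolding hausdorff_measure_eq_0_iff
proof (intro allI impI)
  fix \<delta> \<epsilon> :: real assume \<delta>: "0 < \<delta>" and \<epsilon>: "0 < \<epsilon>"
  have "\<exists>C :: nat \<Rightarrow> 'a set. A n \<subseteq> (\<Union>i. C i) \<and> (\<forall>i. bounded (C i) \<and> diameter (C i) \<le> \<delta>) \<and>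
     (\<Sum>i. cover_weight k (C i)) \<le> ennreal (\<epsilon> * (1/2) ^ Suc n)" for n
  proof -
    have "0 < \<epsilon> * (1/2) ^ Suc n" using \<epsilon> by simp
    with assms[of n] \<delta> show ?thesis unfolding hausdorff_measure_eq_0_iff by blast
  qed
  then obtain C :: "nat \<Rightarrow> nat \<Rightarrow> 'a set" where
    C: "\<And>n. A n \<subseteq> (\<Union>i. C n i) \<and> (\<forall>i. bounded (C n i) \<and> diameter (C n i) \<le> \<delta>) \<and>
       (\<Sum>i. cover_weight k (C n i)) \<le> ennreal (\<epsilon> * (1/2) ^ Suc n)"
    by metis
  define D where "D j = (case prod_decode j of (n, i) \<Rightarrow> C n i)" for j
  have "(\<Sum>j. cover_weight k (D j)) = (\<Sum>n. \<Sum>i. cover_weight k (C n i))"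
    using suminf_ennreal_2dimen[of "\<lambda>n. \<Sum>i. cover_weight k (C n i)" "\<lambda>(n, i). cover_weight k (C n i)"]
    by (simp add: D_def o_def case_prod_unfold)
  also have "\<dots> \<le> (\<Sum>n. ennreal (\<epsilon> * (1/2) ^ Suc n))"
    using C by (intro suminf_le) auto
  also have "\<dots> = ennreal \<epsilon>"
    using \<epsilon> sums_mult[OF power_half_series, of \<epsilon>]
    by (intro suminf_ennreal_eq) simp_all
  finally have sum: "(\<Sum>j. cover_weight k (D j)) \<le> ennreal \<epsilon>" .
  have "(\<Union>n. A n) \<subseteq> (\<Union>j. D j)"
  proof
    fix x assume "x \<in> (\<Union>n. A n)"
    then obtain n i where "x \<in> C n i" using C by blast
    then have "x \<in> D (prod_encode (n, i))" by (simp add: D_def)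
    then show "x \<in> (\<Union>j. D j)" by blast
  qed
  moreover have "bounded (D j) \<and> diameter (D j) \<le> \<delta>" for j
    using C by (simp add: D_def case_prod_unfold)
  ultimately show "\<exists>C. (\<Union>n. A n) \<subseteq> (\<Union>i. C i) \<and> (\<forall>i. bounded (C i) \<and> diameter (C i) \<le> \<delta>) \<and>
     (\<Sum>i. cover_weight k (C i)) \<le> ennreal \<epsilon>"
    using sum by blast
qed

lemma hausdorff_measure_0_countable_UN:
  assumes "countable I" "\<And>i. i \<in> I \<Longrightarrow> hausdorff_measure k (A i) = 0"
  shows "hausdorff_measure k (\<Union>i\<in>I. A i) = 0"
proof (cases "I = {}")
  case True
  \<comment> \<open>Empty covering sets weigh 0 even for \<open>k = 0\<close>, where the power alone
    would be 1.\<close>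
  have "hausdorff_measure k ({} :: 'b set) = 0"
    unfolding hausdorff_measure_eq_0_iff
    by (auto intro!: exI[of _ "\<lambda>_. {}"] simp: diameter_def cover_weight_def)
  then show ?thesis using True by simp
next
  case False
  then have "(\<Union>i\<in>I. A i) = (\<Union>n. A (from_nat_into I n))"
    using range_from_nat_into[OF False assms(1)] by (metis image_image)
  then show ?thesis
    using hausdorff_measure_0_UN[of k "\<lambda>n. A (from_nat_into I n)"] assms(2) from_nat_into[OF False] by simp
qed

text \<open>The bound is asked of finite subfamilies because it will come from finite additivity
  over disjoint columns. A countable family of balls becomes a sequence by filling the remaining
  indices with empty sets, which weigh nothing.\<close>

lemma ball_cover_sum_le:
  fixes A :: "'a::euclidean_space set"
  assumes "countable J" "A \<subseteq> (\<Union>j\<in>J. ball (c j) (\<rho> j))"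
    and \<rho>: "\<And>j. j \<in> J \<Longrightarrow> 0 < \<rho> j \<and> 2 * \<rho> j \<le> \<delta>" and "0 < \<delta>"
    and sum: "\<And>F. finite F \<Longrightarrow> F \<subseteq> J \<Longrightarrow> (\<Sum>j\<in>F. unit_ball_vol (real k) * \<rho> j ^ k) \<le> \<epsilon>"
  shows "\<exists>C :: nat \<Rightarrow> 'a set.
     A \<subseteq> (\<Union>i. C i) \<and> (\<forall>i. bounded (C i) \<and> diameter (C i) \<le> \<delta>) \<and>
     (\<Sum>i. cover_weight k (C i)) \<le> ennreal \<epsilon>"
proof -
  define g where "g = the_inv_into J (to_nat_on J)"
  define I where "I = to_nat_on J ` J"
  define C where "C i = (if i \<in> I then ball (c (g i)) (\<rho> (g i)) else {})" for i
  have inj: "inj_on (to_nat_on J) J" using assms(1) by (rule inj_on_to_nat_on)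
  have gJ: "g i \<in> J" if "i \<in> I" for i
    using that inj unfolding I_def g_def by (auto simp: the_inv_into_f_f)
  have ginj: "inj_on g I"
    unfolding I_def g_def using inj by (simp add: inj_on_the_inv_into)
  have "A \<subseteq> (\<Union>i. C i)"
  proof
    fix x assume "x \<in> A"
    then obtain j where j: "j \<in> J" "x \<in> ball (c j) (\<rho> j)" using assms(2) by blast
    then have "x \<in> C (to_nat_on J j)"
      using inj unfolding C_def I_def g_def by (simp add: the_inv_into_f_f)
    then show "x \<in> (\<Union>i. C i)" by blast
  qed
  moreover have "bounded (C i) \<and> diameter (C i) \<le> \<delta>" for i
    using \<rho>[OF gJ, of i] assms(4) by (auto simp: C_def)
  moreover have "(\<Sum>i. cover_weight k (C i)) \<le> ennreal \<epsilon>"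
  proof (rule suminf_le_const)
    fix n
    have "(\<Sum>i<n. cover_weight k (C i)) = (\<Sum>i\<in>{..<n} \<inter> I. cover_weight k (C i))"
      by (rule sum.mono_neutral_right) (auto simp: C_def cover_weight_def)
    also have "\<dots> \<le> (\<Sum>i\<in>{..<n} \<inter> I. ennreal (unit_ball_vol (real k) * \<rho> (g i) ^ k))"
      using \<rho>[OF gJ] by (intro sum_mono) (fastforce simp: C_def cover_weight_def)
    also have "\<dots> = ennreal (\<Sum>i\<in>{..<n} \<inter> I. unit_ball_vol (real k) * \<rho> (g i) ^ k)"
      using \<rho>[OF gJ] by (intro sum_ennreal) (auto intro!: mult_nonneg_nonneg less_imp_le)
    also have "(\<Sum>i\<in>{..<n} \<inter> I. unit_ball_vol (real k) * \<rho> (g i) ^ k)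
        = (\<Sum>j\<in>g ` ({..<n} \<inter> I). unit_ball_vol (real k) * \<rho> j ^ k)"
      using ginj by (subst sum.reindex) (auto intro: inj_on_subset)
    also have "\<dots> \<le> \<epsilon>" using gJ by (intro sum) auto
    finally show "(\<Sum>i<n. cover_weight k (C i)) \<le> ennreal \<epsilon>" by (simp add: ennreal_leI)
  qed simp
  ultimately show ?thesis by blast
qed

subsection \<open>Test functions\<close>

text \<open>Squaring makes the positive part continuously differentiable across 0; the cutoff
  functions are built from this one nonlinearity.\<close>

lemma max_0_power2_deriv: "((\<lambda>s::real. (max 0 s)\<^sup>2) has_real_derivative 2 * max 0 s) (at s)"
proof -
  consider "s < 0" | "s > 0" | "s = 0" by linarith
  then show ?thesis
  proof cases
    case 1
    have "((\<lambda>s::real. 0) has_real_derivative 2 * max 0 s) (at s)" using 1 by simp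
    then show ?thesis
      by (rule DERIV_cong_ev[OF refl _ refl, THEN iffD1, rotated])
         (use eventually_nhds_in_open[of "{..<0}" s] 1 in \<open>auto elim!: eventually_mono\<close>)
  next
    case 2
    have "((\<lambda>s::real. s\<^sup>2) has_real_derivative 2 * max 0 s) (at s)"
      using 2 by (auto intro!: derivative_eq_intros)
    then show ?thesis
      by (rule DERIV_cong_ev[OF refl _ refl, THEN iffD1, rotated])
         (use eventually_nhds_in_open[of "{0<..}" s] 2 in \<open>auto elim!: eventually_mono\<close>)
  next
    case 3
    have "((\<lambda>h::real. max 0 h) \<longlongrightarrow> 0) (at 0)" by (auto intro!: tendsto_eq_intros)
    moreover have "(max 0 h)\<^sup>2 / h = max 0 h" for h :: real
      by (simp add: max_def power2_eq_square)
    ultimately show ?thesis using 3 by (simp add: DERIV_def)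
  qed
qed

text \<open>Finitely many balls, with closed balls inside \<open>U\<close>, cover \<open>K\<close>.
  The sum of the squared positive parts of r^2 - |x - c|^2 is C^1, positive on \<open>K\<close> and
  zero off the closed balls. By compactness it has a positive minimum on \<open>K\<close>, and it is
  flattened above that value. \<open>G\<close> is the gradient of \<phi>.\<close>

lemma C1_urysohn:
  fixes K U :: "'a::euclidean_space set"
  assumes "compact K" "open U" "K \<subseteq> U"
  obtains \<phi> :: "'a \<Rightarrow> real" and G :: "'a \<Rightarrow> 'a" and S
  where "\<And>x. (\<phi> has_derivative (\<lambda>h. h \<bullet> G x)) (at x)" "continuous_on UNIV G"
    "\<And>x. 0 \<le> \<phi> x" "\<And>x. \<phi> x \<le> 1" "\<And>x. x \<in> K \<Longrightarrow> \<phi> x = 1"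
    "compact S" "S \<subseteq> U" "\<And>x. x \<notin> S \<Longrightarrow> \<phi> x = 0"
proof (cases "K = {}")
  case True
  show ?thesis
    by (rule that[of "\<lambda>_. 0" "\<lambda>_. 0" "{}"]) (use True in auto)
next
  case False
  have "\<exists>r>0. cball x r \<subseteq> U" if "x \<in> K" for x
    using assms that open_contains_cball by blast
  then obtain r where r: "\<And>x. x \<in> K \<Longrightarrow> 0 < r x" "\<And>x. x \<in> K \<Longrightarrow> cball x (r x) \<subseteq> U"
    by metis
  obtain F where F: "F \<subseteq> K" "finite F" "K \<subseteq> (\<Union>c\<in>F. ball c (r c))"
  proof (rule compactE_image[OF assms(1), of K "\<lambda>x. ball x (r x)"])
    show "K \<subseteq> (\<Union>c\<in>K. ball c (r c))" using r(1) by auto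
  qed auto
  define b where "b c x = (max 0 ((r c)\<^sup>2 - (x - c) \<bullet> (x - c)))\<^sup>2" for c x
  define \<eta> where "\<eta> x = (\<Sum>c\<in>F. b c x)" for x
  define H where "H x = (\<Sum>c\<in>F. (- 4 * max 0 ((r c)\<^sup>2 - (x - c) \<bullet> (x - c))) *\<^sub>R (x - c))" for x
  have b_deriv: "(b c has_derivative (\<lambda>h. h \<bullet> ((- 4 * max 0 ((r c)\<^sup>2 - (x - c) \<bullet> (x - c))) *\<^sub>R (x - c)))) (at x)"
    for c x
  proof -
    have "((\<lambda>x. (r c)\<^sup>2 - (x - c) \<bullet> (x - c)) has_derivative (\<lambda>h. - 2 * (h \<bullet> (x - c)))) (at x)"
      by (auto intro!: derivative_eq_intros simp: inner_commute)
    from has_derivative_compose[OF this max_0_power2_deriv[unfolded has_field_derivative_def]]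
    show ?thesis unfolding b_def by (simp add: algebra_simps)
  qed
  have \<eta>_deriv: "(\<eta> has_derivative (\<lambda>h. h \<bullet> H x)) (at x)" for x
    unfolding \<eta>_def H_def inner_sum_right by (rule has_derivative_sum) (rule b_deriv)
  have H_cont: "continuous_on UNIV H"
    unfolding H_def by (intro continuous_intros)
  have b_nonneg: "0 \<le> b c x" for c x by (simp add: b_def)
  then have \<eta>_nonneg: "0 \<le> \<eta> x" for x by (simp add: \<eta>_def sum_nonneg)
  have \<eta>_pos: "0 < \<eta> x" if xK: "x \<in> K" for x
  proof -
    obtain c where c: "c \<in> F" "x \<in> ball c (r c)" using F(3) xK by blast
    have "norm (x - c) < r c" using c(2) by (simp add: dist_norm norm_minus_commute)
    then have "(x - c) \<bullet> (x - c) < (r c)\<^sup>2"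
      unfolding dot_square_norm by (intro power_strict_mono) auto
    then have "0 < b c x" by (simp add: b_def)
    then show ?thesis unfolding \<eta>_def using c(1) F(2) b_nonneg by (intro sum_pos2) auto
  qed
  have "continuous_on K \<eta>"
    using \<eta>_deriv by (meson has_derivative_continuous continuous_at_imp_continuous_on)
  from continuous_attains_inf[OF assms(1) False this]
  obtain x0 where x0: "x0 \<in> K" "\<And>y. y \<in> K \<Longrightarrow> \<eta> x0 \<le> \<eta> y" by blast
  define m where "m = \<eta> x0"
  have m: "0 < m" "\<And>y. y \<in> K \<Longrightarrow> m \<le> \<eta> y" using x0 \<eta>_pos by (auto simp: m_def)
  \<comment> \<open>The function 1 - max(0, 1 - t)^2 of t is C^1, is 0 at t = 0 and 1 for t \<ge> 1.
    Composed with \<eta> / m it is therefore 1 on \<open>K\<close>.\<close>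
  define \<phi> where "\<phi> x = 1 - (max 0 (1 - \<eta> x / m))\<^sup>2" for x
  show ?thesis
  proof (rule that[of \<phi> "\<lambda>x. (2 * max 0 (1 - \<eta> x / m) / m) *\<^sub>R H x" "\<Union>c\<in>F. cball c (r c)"])
    fix x
    have "((\<lambda>x. 1 - \<eta> x / m) has_derivative (\<lambda>h. - (h \<bullet> H x) / m)) (at x)"
      using \<eta>_deriv[of x] m(1) by (auto intro!: derivative_eq_intros simp: field_simps)
    from has_derivative_diff[OF has_derivative_const[of 1] has_derivative_compose[OF this max_0_power2_deriv[unfolded has_field_derivative_def]]]
    show "(\<phi> has_derivative (\<lambda>h. h \<bullet> (2 * max 0 (1 - \<eta> x / m) / m) *\<^sub>R H x)) (at x)"
      unfolding \<phi>_def by (simp add: algebra_simps)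
  next
    have "continuous_on UNIV \<eta>"
      using \<eta>_deriv by (meson has_derivative_continuous continuous_at_imp_continuous_on)
    then show "continuous_on UNIV (\<lambda>x. (2 * max 0 (1 - \<eta> x / m) / m) *\<^sub>R H x)"
      using H_cont m(1) by (intro continuous_intros) auto
  next
    fix x
    have "max 0 (1 - \<eta> x / m) \<le> 1" using \<eta>_nonneg[of x] m(1) by simp
    then show "0 \<le> \<phi> x" by (simp add: \<phi>_def power_le_one)
    show "\<phi> x \<le> 1" by (simp add: \<phi>_def)
    show "\<phi> x = 1" if "x \<in> K" using m(1) m(2)[OF that] by (simp add: \<phi>_def)
  next
    show "compact (\<Union>c\<in>F. cball c (r c))" using F(2) by (intro compact_UN) auto
    show "(\<Union>c\<in>F. cball c (r c)) \<subseteq> U" using F(1) r(2) by blast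
    fix x assume x: "x \<notin> (\<Union>c\<in>F. cball c (r c))"
    have "b c x = 0" if "c \<in> F" for c
    proof -
      have "r c \<le> norm (x - c)" "0 < r c" using x that F(1) r(1) by (auto simp: dist_norm norm_minus_commute)
      then have "(r c)\<^sup>2 \<le> (x - c) \<bullet> (x - c)"
        unfolding dot_square_norm by (intro power_mono) auto
      then show ?thesis by (simp add: b_def)
    qed
    then show "\<phi> x = 0" by (simp add: \<phi>_def \<eta>_def)
  qed
qed

text \<open>For smooth \<open>f\<close> the derivative of this integral along \<open>e\<close> is
  f(y) - f(y - \<tau> e), a difference of a value and its translate. The codomain is general so that
  the operation applies to a function and to its gradient alike.\<close>

definition line_integral :: "real \<Rightarrow> 'a::euclidean_space \<Rightarrow> ('a \<Rightarrow> 'b::euclidean_space) \<Rightarrow> 'a \<Rightarrow> 'b" where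
  "line_integral \<tau> e f y = integral (cbox 0 \<tau>) (\<lambda>s. f (y - s *\<^sub>R e))"

text \<open>Differentiation under the integral sign. The gradient passes through
  \<open>blinfun_inner_left\<close> because the Leibniz rule wants the derivative as a continuous
  family of bounded linear maps.\<close>

lemma has_derivative_line_integral:
  fixes \<phi> :: "'a::euclidean_space \<Rightarrow> real"
  assumes \<phi>: "\<And>x. (\<phi> has_derivative (\<lambda>h. h \<bullet> G x)) (at x)" and G: "continuous_on UNIV G"
  shows "(line_integral \<tau> e \<phi> has_derivative (\<lambda>h. h \<bullet> line_integral \<tau> e G y)) (at y)"
proof -
  have c\<phi>: "continuous_on UNIV \<phi>"
    using \<phi> by (meson has_derivative_continuous continuous_at_imp_continuous_on)
  have comp: "((\<lambda>x. \<phi> (x - t *\<^sub>R e)) has_derivative blinfun_apply (blinfun_inner_left (G (x - t *\<^sub>R e)))) (at x)"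
    for x t
  proof -
    have "((\<lambda>x. x - t *\<^sub>R e) has_derivative (\<lambda>h. h)) (at x)"
      by (auto intro!: derivative_eq_intros)
    from has_derivative_compose[OF this \<phi>] show ?thesis by simp
  qed
  have "continuous_on (UNIV \<times> cbox 0 \<tau>) (\<lambda>(x, t). blinfun_inner_left (G (x - t *\<^sub>R e)))"
    unfolding split_beta
    by (intro bounded_linear.continuous_on[OF bounded_linear_blinfun_inner_left]
        continuous_on_compose2[OF G] continuous_intros) auto
  moreover have "(\<lambda>t. \<phi> (x - t *\<^sub>R e)) integrable_on cbox 0 \<tau>" for x
    by (intro integrable_continuous continuous_on_compose2[OF c\<phi>] continuous_intros) auto
  ultimately have "(line_integral \<tau> e \<phi> has_derivative
     integral (cbox 0 \<tau>) (\<lambda>t. blinfun_inner_left (G (y - t *\<^sub>R e)))) (at y)"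
    unfolding line_integral_def[abs_def] using comp
    by (intro leibniz_rule) auto
  also have "integral (cbox 0 \<tau>) (\<lambda>t. blinfun_inner_left (G (y - t *\<^sub>R e)))
      = blinfun_inner_left (line_integral \<tau> e G y)"
    unfolding line_integral_def
    by (intro integral_linear[OF _ bounded_linear_blinfun_inner_left, unfolded o_def]
        integrable_continuous continuous_on_compose2[OF G] continuous_intros) auto
  finally show ?thesis by simp
qed

text \<open>The divergence of \<psi> e is the derivative of \<psi> along \<open>e\<close>, which the
  fundamental theorem of calculus evaluates for a line integral. The support lies in the set swept
  by \<open>S\<close> under translations up to \<tau>, hence the condition on
  \<open>V\<close>.\<close>

lemma line_integral_test_field:
  fixes \<phi> :: "real^'n \<Rightarrow> real"
  assumes \<phi>: "\<And>x. (\<phi> has_derivative (\<lambda>h. h \<bullet> G x)) (at x)" and G: "continuous_on UNIV G"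
    and S: "compact S" "\<And>x. x \<notin> S \<Longrightarrow> \<phi> x = 0" and \<tau>: "0 \<le> \<tau>"
    and V: "\<And>x s. x \<in> S \<Longrightarrow> 0 \<le> s \<Longrightarrow> s \<le> \<tau> \<Longrightarrow> x + s *\<^sub>R e \<in> V"
  shows "(\<lambda>y. line_integral \<tau> e \<phi> y *\<^sub>R e) \<in> C1_compact_support V"
    and "divergence (\<lambda>y. line_integral \<tau> e \<phi> y *\<^sub>R e) y = \<phi> y - \<phi> (y - \<tau> *\<^sub>R e)"
proof -
  let ?W = "\<lambda>y. line_integral \<tau> e \<phi> y *\<^sub>R e"
  let ?H = "line_integral \<tau> e G"
  have W: "(?W has_derivative (\<lambda>h. (h \<bullet> ?H y) *\<^sub>R e)) (at y)" for y
    by (intro has_derivative_scaleR_left has_derivative_line_integral \<phi> G)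
  then have fW: "frechet_derivative ?W (at y) = (\<lambda>h. (h \<bullet> ?H y) *\<^sub>R e)" for y
    using frechet_derivative_at by metis
  have "continuous_on (UNIV \<times> cbox 0 \<tau>) (\<lambda>(x, t). G (x - t *\<^sub>R e))"
    unfolding split_beta by (intro continuous_on_compose2[OF G] continuous_intros) auto
  from integral_continuous_on_param[OF this] have "continuous_on UNIV ?H"
    unfolding line_integral_def .
  then have "continuous_on UNIV (\<lambda>x. frechet_derivative ?W (at x) h)" for h
    unfolding fW by (intro continuous_intros)
  moreover have "?W differentiable (at x)" for x using W unfolding differentiable_def by blast
  moreover
  let ?S' = "(\<lambda>(x, s). x + s *\<^sub>R e) ` (S \<times> {0..\<tau>})"
  have S': "compact ?S'"
    unfolding split_beta by (intro compact_continuous_image compact_Times S continuous_intros) auto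
  have "line_integral \<tau> e \<phi> y = 0" if "y \<notin> ?S'" for y
    unfolding line_integral_def
  proof (intro integral_unique has_integral_is_0)
    show "\<phi> (y - s *\<^sub>R e) = 0" if s: "s \<in> cbox 0 \<tau>" for s
    proof (rule S(2))
      show "y - s *\<^sub>R e \<notin> S"
      proof
        assume "y - s *\<^sub>R e \<in> S"
        then have "(y - s *\<^sub>R e, s) \<in> S \<times> {0..\<tau>}" using s by simp
        then have "y \<in> ?S'" by (rule rev_image_eqI) simp
        then show False using \<open>y \<notin> ?S'\<close> by simp
      qed
    qed
  qed
  then have "{y. ?W y \<noteq> 0} \<subseteq> ?S'" by auto
  then have sub: "closure {y. ?W y \<noteq> 0} \<subseteq> ?S'"
    using S' by (intro closure_minimal compact_imp_closed)
  then have "compact (closure {y. ?W y \<noteq> 0})"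
    using bounded_subset[OF compact_imp_bounded[OF S'] sub] by (simp add: compact_eq_bounded_closed)
  moreover have "?S' \<subseteq> V" using V by auto
  ultimately show "?W \<in> C1_compact_support V"
    unfolding C1_compact_support_def using sub by (auto intro: order_trans)
  have "divergence ?W y = (\<Sum>i\<in>UNIV. (axis i 1 \<bullet> ?H y) * e $ i)"
    by (simp add: divergence_def fW)
  also have "\<dots> = e \<bullet> ?H y"
    unfolding inner_axis' inner_vec_def[of e] by (simp add: mult.commute)
  also have "\<dots> = integral (cbox 0 \<tau>) (\<lambda>s. e \<bullet> G (y - s *\<^sub>R e))"
    unfolding line_integral_def
    by (intro integral_linear[OF _ bounded_linear_inner_right, unfolded o_def, symmetric]
        integrable_continuous continuous_on_compose2[OF G] continuous_intros) auto
  \<comment> \<open>The integrand is the \<open>s\<close>-derivative of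
    \<open>- \<phi> (y - s *\<^sub>R e)\<close>.\<close>
  also have "\<dots> = - \<phi> (y - \<tau> *\<^sub>R e) - (- \<phi> (y - 0 *\<^sub>R e))"
    unfolding cbox_interval
  proof (intro integral_unique fundamental_theorem_of_calculus \<tau>)
    fix s
    have "((\<lambda>s. y - s *\<^sub>R e) has_derivative (\<lambda>h. - h *\<^sub>R e)) (at s within {0..\<tau>})"
      by (auto intro!: derivative_eq_intros)
    from has_derivative_minus[OF has_derivative_compose[OF this \<phi>]]
    show "((\<lambda>s. - \<phi> (y - s *\<^sub>R e)) has_vector_derivative e \<bullet> G (y - s *\<^sub>R e)) (at s within {0..\<tau>})"
      by (simp add: has_vector_derivative_def)
  qed
  finally show "divergence ?W y = \<phi> y - \<phi> (y - \<tau> *\<^sub>R e)" by simp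
qed

text \<open>The bound is uniform in \<tau>: a line in direction \<open>e\<close> meets the ball only
  for parameters in an interval of length 2r. This factor \<open>r\<close> gives the slide estimate
  its scaling.\<close>

lemma line_integral_bound:
  fixes \<phi> :: "'a::euclidean_space \<Rightarrow> real"
  assumes c: "continuous_on UNIV \<phi>" and b: "\<And>x. 0 \<le> \<phi> x" "\<And>x. \<phi> x \<le> 1"
    and S: "\<And>x. x \<notin> ball c r \<Longrightarrow> \<phi> x = 0" and e: "norm e = 1" and r: "0 < r"
  shows "norm (line_integral \<tau> e \<phi> y *\<^sub>R e) \<le> 2 * r"
proof -
  \<comment> \<open>At parameter \<open>a\<close> the line y - s e is closest to \<open>c\<close>,
    so |a - s| bounds the distance to \<open>c\<close> from below.\<close>
  define a where "a = (y - c) \<bullet> e"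
  have zero: "\<phi> (y - s *\<^sub>R e) = 0" if "s \<notin> cbox (a - r) (a + r)" for s
  proof (rule S)
    have ee: "e \<bullet> e = 1" using e by (simp add: norm_eq_1)
    have "\<bar>a - s\<bar> = \<bar>(y - s *\<^sub>R e - c) \<bullet> e\<bar>"
      by (simp add: a_def inner_diff_left ee)
    also have "\<dots> \<le> norm (y - s *\<^sub>R e - c)"
      using Cauchy_Schwarz_ineq2[of "y - s *\<^sub>R e - c" e] e by simp
    finally show "y - s *\<^sub>R e \<notin> ball c r"
      using that by (auto simp: dist_norm norm_minus_commute)
  qed
  have cont: "continuous_on A (\<lambda>s. \<phi> (y - s *\<^sub>R e))" for A
    by (intro continuous_on_compose2[OF c] continuous_intros) auto
  have "line_integral \<tau> e \<phi> y = integral (cbox 0 \<tau>) (\<lambda>s. if s \<in> cbox (a - r) (a + r) then \<phi> (y - s *\<^sub>R e) else 0)"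
    unfolding line_integral_def by (intro integral_cong) (use zero in auto)
  also have "\<dots> = integral (cbox (a - r) (a + r) \<inter> cbox 0 \<tau>) (\<lambda>s. \<phi> (y - s *\<^sub>R e))"
    by (subst integral_restrict_Int) simp
  also have "\<dots> \<le> integral (cbox (a - r) (a + r)) (\<lambda>s. \<phi> (y - s *\<^sub>R e))"
    using b unfolding Int_interval
    by (intro integral_subset_le integrable_continuous cont) (auto simp: max_def min_def)
  also have "\<dots> \<le> integral (cbox (a - r) (a + r)) (\<lambda>s. 1)"
    using b by (intro integral_le integrable_continuous cont) auto
  also have "\<dots> = 2 * r" using r by simp
  finally have "line_integral \<tau> e \<phi> y \<le> 2 * r" .
  moreover have "0 \<le> line_integral \<tau> e \<phi> y"
    unfolding line_integral_def using b by (intro integral_nonneg integrable_continuous cont) auto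
  ultimately show ?thesis using e by simp
qed

subsection \<open>Sliding along a direction\<close>

lemma C1_compact_support_scaleR:
  assumes "W \<in> C1_compact_support V"
  shows "(\<lambda>x. c *\<^sub>R W x) \<in> C1_compact_support V"
    and "divergence (\<lambda>x. c *\<^sub>R W x) x = c * divergence W x"
proof -
  have "(W has_derivative frechet_derivative W (at x)) (at x)" for x
    using assms frechet_derivative_works by (auto simp: C1_compact_support_def)
  then have d: "((\<lambda>x. c *\<^sub>R W x) has_derivative (\<lambda>h. c *\<^sub>R frechet_derivative W (at x) h)) (at x)" for x
    by (rule has_derivative_scaleR_right)
  then have f: "frechet_derivative (\<lambda>x. c *\<^sub>R W x) (at x) = (\<lambda>h. c *\<^sub>R frechet_derivative W (at x) h)" for x
    using frechet_derivative_at by metis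
  have sub: "closure {x. c *\<^sub>R W x \<noteq> 0} \<subseteq> closure {x. W x \<noteq> 0}"
    by (intro closure_mono) auto
  moreover have "compact (closure {x. c *\<^sub>R W x \<noteq> 0})"
    using bounded_subset[OF compact_imp_bounded sub] assms
    by (simp add: compact_eq_bounded_closed C1_compact_support_def)
  moreover have "(\<lambda>x. c *\<^sub>R W x) differentiable (at x)" for x
    using d unfolding differentiable_def by blast
  moreover have "continuous_on UNIV (\<lambda>x. frechet_derivative (\<lambda>x. c *\<^sub>R W x) (at x) h)" for h
    unfolding f using assms by (intro continuous_intros) (auto simp: C1_compact_support_def)
  ultimately show "(\<lambda>x. c *\<^sub>R W x) \<in> C1_compact_support V"
    using assms unfolding C1_compact_support_def by (auto intro: order_trans)
  show "divergence (\<lambda>x. c *\<^sub>R W x) x = c * divergence W x"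
    by (simp add: divergence_def f sum_distrib_left)
qed

text \<open>Absolute continuity of the integral: the part of |g| above a high level \<open>n\<close>
  has small integral, and elsewhere |g| is at most \<open>n\<close>.\<close>

lemma set_integral_abs_small:
  fixes g :: "'a \<Rightarrow> real"
  assumes g: "integrable M g" and \<epsilon>: "0 < \<epsilon>"
  obtains \<delta> where "0 < \<delta>"
    "\<And>A. A \<in> sets M \<Longrightarrow> emeasure M A < ennreal \<delta> \<Longrightarrow> (LINT x:A|M. \<bar>g x\<bar>) < \<epsilon>"
proof -
  have [measurable]: "g \<in> borel_measurable M" using g by simp
  define L where "L n = {x \<in> space M. real n < \<bar>g x\<bar>}" for n
  have [measurable]: "L n \<in> sets M" for n unfolding L_def by measurable
  have int: "set_integrable M A (\<lambda>x. \<bar>g x\<bar>)" if "A \<in> sets M" for A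
    unfolding set_integrable_def using that g by (intro integrable_mult_indicator) auto
  have "(\<lambda>n. LINT x:L n|M. \<bar>g x\<bar>) \<longlonglongrightarrow> (LINT x:(\<Inter>n. L n)|M. \<bar>g x\<bar>)"
    by (rule set_integral_cont_down) (auto simp: decseq_def L_def intro!: int)
  also have "(\<Inter>n. L n) = {}"
  proof -
    have "x \<notin> (\<Inter>n. L n)" for x
    proof -
      obtain n :: nat where "\<bar>g x\<bar> < real n" using reals_Archimedean2 by blast
      then have "x \<notin> L n" by (simp add: L_def)
      then show ?thesis by blast
    qed
    then show ?thesis by blast
  qed
  finally have "(\<lambda>n. LINT x:L n|M. \<bar>g x\<bar>) \<longlonglongrightarrow> 0"
    by (simp add: set_lebesgue_integral_def)
  then have "\<forall>\<^sub>F n in sequentially. (LINT x:L n|M. \<bar>g x\<bar>) < \<epsilon> / 2"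
    using \<epsilon> by (intro order_tendstoD(2)) auto
  then obtain n where n: "(LINT x:L n|M. \<bar>g x\<bar>) < \<epsilon> / 2"
    by (auto simp: eventually_sequentially)
  \<comment> \<open>The summand 1 keeps the denominator positive when \<open>n = 0\<close>.\<close>
  define \<delta> where "\<delta> = \<epsilon> / (2 * (real n + 1))"
  show ?thesis
  proof (rule that[of \<delta>])
    show "0 < \<delta>" using \<epsilon> by (simp add: \<delta>_def)
    fix A assume A[measurable]: "A \<in> sets M" and small: "emeasure M A < ennreal \<delta>"
    have fin: "emeasure M A < \<infinity>" using order.strict_trans[OF small ennreal_less_top] by simp
    have "emeasure M A = ennreal (measure M A)"
      using fin by (intro emeasure_eq_ennreal_measure) auto
    then have m: "measure M A < \<delta>"
      using small by (simp add: ennreal_less_iff)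
    have i1: "integrable M (indicat_real A)" using fin by (simp add: integrable_real_indicator)
    have "(LINT x:A|M. \<bar>g x\<bar>) \<le> (LINT x|M. real n * indicator A x + indicator (L n) x *\<^sub>R \<bar>g x\<bar>)"
      unfolding set_lebesgue_integral_def
    proof (intro integral_mono)
      show "integrable M (\<lambda>x. indicat_real A x *\<^sub>R \<bar>g x\<bar>)"
        using int[OF A] by (simp add: set_integrable_def)
      show "integrable M (\<lambda>x. real n * indicat_real A x + indicat_real (L n) x *\<^sub>R \<bar>g x\<bar>)"
        using int[of "L n"] i1 by (intro Bochner_Integration.integrable_add integrable_mult_right) (simp_all add: set_integrable_def)
      fix x assume "x \<in> space M"
      then show "indicat_real A x *\<^sub>R \<bar>g x\<bar> \<le> real n * indicat_real A x + indicat_real (L n) x *\<^sub>R \<bar>g x\<bar>"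
        by (auto simp: indicator_def L_def)
    qed
    also have "\<dots> = real n * measure M A + (LINT x:L n|M. \<bar>g x\<bar>)"
      using i1 int[of "L n"] by (simp add: set_lebesgue_integral_def set_integrable_def)
    also have "real n * measure M A \<le> real n * \<delta>"
      using m by (intro mult_left_mono) auto
    also have "real n * \<delta> \<le> \<epsilon> / 2"
      using \<epsilon> by (simp add: \<delta>_def field_simps)
    finally show "(LINT x:A|M. \<bar>g x\<bar>) < \<epsilon>" using n by simp
  qed
qed

text \<open>Test with the line integral of a smooth \<phi> close to the indicator of {w > 0} in
  \<open>Q\<close>. Its divergence is \<phi> minus the translate of \<phi> by \<tau> e, so the
  positive mass in \<open>Q\<close> is bounded by the mass in the translate of \<open>Q\<close>, up
  to 2r times the variation.\<close>

lemma slide_estimate_pos: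
  fixes w :: "real^'n \<Rightarrow> real"
  assumes w: "integrable lebesgue w"
    and B: "\<And>W. W \<in> C1_compact_support V \<Longrightarrow> (\<And>x. norm (W x) \<le> 1) \<Longrightarrow>
       (LINT x:V|lebesgue. w x * divergence W x) \<le> B"
    and e: "norm e = 1" and r: "0 < r" and \<tau>: "0 \<le> \<tau>" and V: "open V"
    and Q: "open Q" "Q \<subseteq> ball c r" "\<And>x s. x \<in> Q \<Longrightarrow> 0 \<le> s \<Longrightarrow> s \<le> \<tau> \<Longrightarrow> x + s *\<^sub>R e \<in> V"
  shows "(LINT x:Q|lebesgue. max 0 (w x)) \<le> (LINT x:{y. y - \<tau> *\<^sub>R e \<in> Q}|lebesgue. \<bar>w x\<bar>) + 2 * r * B"
proof (rule field_le_epsilon)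
  fix \<epsilon> :: real assume "0 < \<epsilon>"
  then have \<epsilon>: "0 < \<epsilon> / 2" by simp
  obtain \<delta> where \<delta>: "0 < \<delta>"
    "\<And>A. A \<in> sets lebesgue \<Longrightarrow> emeasure lebesgue A < ennreal \<delta> \<Longrightarrow> (LINT x:A|lebesgue. \<bar>w x\<bar>) < \<epsilon> / 2"
    using set_integral_abs_small[OF w \<epsilon>] by blast
  have [measurable]: "w \<in> borel_measurable lebesgue" using w by simp
  have [measurable]: "Q \<in> sets lebesgue" "V \<in> sets lebesgue" using Q(1) V by auto
  define Q' where "Q' = {y. y - \<tau> *\<^sub>R e \<in> Q}"
  have "open ((\<lambda>y. y - \<tau> *\<^sub>R e) -` Q)"
    by (intro continuous_open_vimage Q(1)) auto
  then have [measurable]: "Q' \<in> sets lebesgue" by (auto simp: Q'_def vimage_def)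
  \<comment> \<open>\<open>E\<close> is squeezed between a compact set and an open set, each up to
    measure \<delta>; \<phi> is 1 on the former and supported in the latter.\<close>
  define E where "E = {x \<in> space lebesgue. 0 < w x} \<inter> Q"
  have E[measurable]: "E \<in> sets lebesgue" unfolding E_def by measurable
  obtain K where K: "closed K" "K \<subseteq> E" "E - K \<in> lmeasurable" "emeasure lebesgue (E - K) < ennreal \<delta>"
    using sets_lebesgue_inner_closed[OF E \<delta>(1)] by blast
  have "bounded K"
    by (rule bounded_subset[of "ball c r"]) (use K(2) Q(2) in \<open>auto simp: E_def\<close>)
  with K(1) have cK: "compact K" by (simp add: compact_eq_bounded_closed)
  have [measurable]: "K \<in> sets lebesgue" using K(1) by auto
  obtain T where T: "open T" "K \<subseteq> T" "T - K \<in> lmeasurable" "emeasure lebesgue (T - K) < ennreal \<delta>"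
    using sets_lebesgue_outer_open[of K \<delta>] \<delta>(1) by auto
  have [measurable]: "T \<in> sets lebesgue" using T(1) by auto
  have oTQ: "open (T \<inter> Q)" using T Q by auto
  have KTQ: "K \<subseteq> T \<inter> Q" using T K by (auto simp: E_def)
  obtain \<phi> G S where \<phi>: "\<And>x. (\<phi> has_derivative (\<lambda>h. h \<bullet> G x)) (at x)" "continuous_on UNIV G"
    "\<And>x. 0 \<le> \<phi> x" "\<And>x. \<phi> x \<le> 1" "\<And>x. x \<in> K \<Longrightarrow> \<phi> x = 1"
    "compact S" "S \<subseteq> T \<inter> Q" "\<And>x. x \<notin> S \<Longrightarrow> \<phi> x = 0"
    using C1_urysohn[OF cK oTQ KTQ] by blast
  have c\<phi>: "continuous_on UNIV \<phi>"
    using \<phi>(1) by (meson has_derivative_continuous continuous_at_imp_continuous_on)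
  then have [measurable]: "\<phi> \<in> borel_measurable lebesgue"
    by (intro measurable_completion) (simp add: borel_measurable_continuous_onI)
  have "continuous_on UNIV (\<lambda>x. \<phi> (x - \<tau> *\<^sub>R e))"
    by (intro continuous_on_compose2[OF c\<phi>] continuous_intros) auto
  then have [measurable]: "(\<lambda>x. \<phi> (x - \<tau> *\<^sub>R e)) \<in> borel_measurable lebesgue"
    by (intro measurable_completion) (simp add: borel_measurable_continuous_onI)
  define W where "W y = line_integral \<tau> e \<phi> y *\<^sub>R e" for y
  have SV: "x + s *\<^sub>R e \<in> V" if "x \<in> S" "0 \<le> s" "s \<le> \<tau>" for x s
    using Q(3) \<phi>(7) that by blast
  have W: "W \<in> C1_compact_support V" "divergence W y = \<phi> y - \<phi> (y - \<tau> *\<^sub>R e)" for y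
    unfolding W_def using line_integral_test_field[OF \<phi>(1,2,6,8) \<tau> SV] by blast+
  have "norm (W y) \<le> 2 * r" for y
    unfolding W_def
    by (rule line_integral_bound[OF c\<phi> \<phi>(3,4) _ e r, of c]) (use \<phi>(7,8) Q(2) in blast)
  \<comment> \<open>Dividing by 2r makes the field admissible for \<open>B\<close>; the factor
    returns in \<open>main\<close>.\<close>
  then have "norm ((1 / (2 * r)) *\<^sub>R W y) \<le> 1" for y
    using r by (simp add: field_simps)
  from B[OF C1_compact_support_scaleR(1)[OF W(1)] this]
  have "(LINT x:V|lebesgue. (1 / (2 * r)) * (w x * (\<phi> x - \<phi> (x - \<tau> *\<^sub>R e)))) \<le> B"
    unfolding C1_compact_support_scaleR(2)[OF W(1)] W(2) by (simp add: algebra_simps)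
  then have main: "(LINT x:V|lebesgue. w x * (\<phi> x - \<phi> (x - \<tau> *\<^sub>R e))) \<le> 2 * r * B"
    using r by (simp only: set_integral_mult_right) (simp add: field_simps)
  have bd: "\<bar>\<phi> x - \<phi> (x - \<tau> *\<^sub>R e)\<bar> \<le> 1" for x
    using \<phi>(3)[of x] \<phi>(3)[of "x - \<tau> *\<^sub>R e"] \<phi>(4)[of x] \<phi>(4)[of "x - \<tau> *\<^sub>R e"] by linarith
  have i1: "integrable lebesgue (\<lambda>x. indicator V x *\<^sub>R (w x * (\<phi> x - \<phi> (x - \<tau> *\<^sub>R e))))"
    by (rule Bochner_Integration.integrable_bound[OF w])
       (use bd in \<open>auto simp: indicator_def abs_mult intro!: mult_left_le\<close>)
  have i2: "integrable lebesgue (\<lambda>x. indicator A x *\<^sub>R \<bar>w x\<bar>)" if "A \<in> sets lebesgue" for A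
    using that w by (intro integrable_mult_indicator) auto
  have i3: "integrable lebesgue (\<lambda>x. indicator Q x *\<^sub>R max 0 (w x))"
    by (rule Bochner_Integration.integrable_bound[OF w]) (auto simp: indicator_def)
  \<comment> \<open>Pointwise accounting: \<open>Q'\<close> pays for the translated cutoff,
    \<open>E - K\<close> for points of \<open>E\<close> where \<phi> may be below 1, and
    \<open>T - K\<close> for points outside \<open>E\<close> where \<phi> may be positive.\<close>
  have "(LINT x:Q|lebesgue. max 0 (w x)) \<le> (LINT x|lebesgue. indicator V x *\<^sub>R (w x * (\<phi> x - \<phi> (x - \<tau> *\<^sub>R e)))
      + indicator Q' x *\<^sub>R \<bar>w x\<bar> + indicator (E - K) x *\<^sub>R \<bar>w x\<bar> + indicator (T - K) x *\<^sub>R \<bar>w x\<bar>)"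
    unfolding set_lebesgue_integral_def
  proof (intro integral_mono i3 i1 i2 Bochner_Integration.integrable_add)
    fix x
    have 1: "\<phi> x = 0" if "x \<notin> T \<inter> Q" using that \<phi>(7,8) by blast
    have 2: "\<phi> (x - \<tau> *\<^sub>R e) = 0" if "x \<notin> Q'" using that \<phi>(7,8) by (auto simp: Q'_def)
    have QV: "x \<in> V" if "x \<in> Q" using Q(3)[OF that, of 0] \<tau> by simp
    have 3: "0 \<le> - (w x * \<phi> (x - \<tau> *\<^sub>R e)) + indicator Q' x * \<bar>w x\<bar>"
    proof (cases "x \<in> Q'")
      case True
      have "w x * \<phi> (x - \<tau> *\<^sub>R e) \<le> \<bar>w x\<bar> * 1"
        using \<phi>(3,4) by (intro mult_mono) auto
      then show ?thesis using True by simp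
    qed (simp add: 2)
    have 4: "indicator Q x * max 0 (w x)
      \<le> w x * \<phi> x + indicator (E - K) x * \<bar>w x\<bar> + indicator (T - K) x * \<bar>w x\<bar>"
    proof (cases "x \<in> K")
      case True
      then show ?thesis using \<phi>(5) KTQ K(2) by (auto simp: indicator_def E_def)
    next
      case False
      have "\<bar>w x * \<phi> x\<bar> \<le> \<bar>w x\<bar>"
        using \<phi>(3,4)[of x] by (simp add: abs_mult mult_left_le)
      then have "- \<bar>w x\<bar> \<le> w x * \<phi> x" by linarith
      moreover have "x \<in> E \<Longrightarrow> 0 \<le> w x * \<phi> x" using \<phi>(3)[of x] by (simp add: E_def)
      ultimately show ?thesis
        using False 1 by (cases "x \<in> E"; cases "x \<in> T"; cases "x \<in> Q") (auto simp: E_def)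
    qed
    show "indicator Q x *\<^sub>R max 0 (w x) \<le> indicator V x *\<^sub>R (w x * (\<phi> x - \<phi> (x - \<tau> *\<^sub>R e)))
      + indicator Q' x *\<^sub>R \<bar>w x\<bar> + indicator (E - K) x *\<^sub>R \<bar>w x\<bar> + indicator (T - K) x *\<^sub>R \<bar>w x\<bar>"
    proof (cases "x \<in> V")
      case True
      then show ?thesis using 3 4 by (simp add: algebra_simps)
    next
      case False
      then have "x \<notin> Q" using QV by blast
      then show ?thesis using False by simp
    qed
  qed auto
  also have "\<dots> = (LINT x:V|lebesgue. w x * (\<phi> x - \<phi> (x - \<tau> *\<^sub>R e))) + (LINT x:Q'|lebesgue. \<bar>w x\<bar>)
      + (LINT x:E - K|lebesgue. \<bar>w x\<bar>) + (LINT x:T - K|lebesgue. \<bar>w x\<bar>)"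
    unfolding set_lebesgue_integral_def using i1 i2 by (simp add: Bochner_Integration.integrable_add)
  also have "\<dots> \<le> 2 * r * B + (LINT x:Q'|lebesgue. \<bar>w x\<bar>) + \<epsilon> / 2 + \<epsilon> / 2"
    using main \<delta>(2)[of "E - K"] \<delta>(2)[of "T - K"] K(4) T(4) by (intro add_mono) (auto intro: less_imp_le)
  finally show "(LINT x:Q|lebesgue. max 0 (w x)) \<le> (LINT x:{y. y - \<tau> *\<^sub>R e \<in> Q}|lebesgue. \<bar>w x\<bar>) + 2 * r * B + \<epsilon>"
    by (simp add: Q'_def)
qed

text \<open>Add the one-sided estimates for \<open>w\<close> and \<open>- w\<close>. Replacing
  \<open>W\<close> by \<open>- W\<close> shows that the hypothesis on \<open>B\<close> is
  insensitive to the sign.\<close>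

lemma slide_estimate:
  fixes w :: "real^'n \<Rightarrow> real"
  assumes w: "integrable lebesgue w"
    and B: "\<And>W. W \<in> C1_compact_support V \<Longrightarrow> (\<And>x. norm (W x) \<le> 1) \<Longrightarrow>
       (LINT x:V|lebesgue. w x * divergence W x) \<le> B"
    and "norm e = 1" "0 < r" "0 \<le> \<tau>" "open V"
    and Q: "open Q" "Q \<subseteq> ball c r" "\<And>x s. x \<in> Q \<Longrightarrow> 0 \<le> s \<Longrightarrow> s \<le> \<tau> \<Longrightarrow> x + s *\<^sub>R e \<in> V"
  shows "(LINT x:Q|lebesgue. \<bar>w x\<bar>) \<le> 2 * (LINT x:{y. y - \<tau> *\<^sub>R e \<in> Q}|lebesgue. \<bar>w x\<bar>) + 4 * r * B"
proof -
  have B': "(LINT x:V|lebesgue. - w x * divergence W x) \<le> B"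
    if "W \<in> C1_compact_support V" "\<And>x. norm (W x) \<le> 1" for W
    using B[OF C1_compact_support_scaleR(1)[OF that(1), of "- 1"]] that(2)
    by (simp add: C1_compact_support_scaleR(2)[OF that(1), of "- 1", simplified])
  have [measurable]: "w \<in> borel_measurable lebesgue" "Q \<in> sets lebesgue" using w Q(1) by auto
  have i: "set_integrable lebesgue Q (\<lambda>x. max 0 (w x))" "set_integrable lebesgue Q (\<lambda>x. max 0 (- w x))"
    unfolding set_integrable_def
    by (rule Bochner_Integration.integrable_bound[OF w]; auto simp: indicator_def)+
  have "\<bar>w x\<bar> = max 0 (w x) + max 0 (- w x)" for x by auto
  then have "(LINT x:Q|lebesgue. \<bar>w x\<bar>) = (LINT x:Q|lebesgue. max 0 (w x)) + (LINT x:Q|lebesgue. max 0 (- w x))"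
    using set_integral_add(2)[OF i] by simp
  also have "\<dots> \<le> ((LINT x:{y. y - \<tau> *\<^sub>R e \<in> Q}|lebesgue. \<bar>w x\<bar>) + 2 * r * B)
      + ((LINT x:{y. y - \<tau> *\<^sub>R e \<in> Q}|lebesgue. \<bar>- w x\<bar>) + 2 * r * B)"
    by (intro add_mono slide_estimate_pos[where V=V and c=c] assms B' integrable_minus) auto
  finally show ?thesis by (simp add: mult.commute mult.left_commute)
qed

subsection \<open>Boundary behaviour in a Lipschitz chart\<close>

text \<open>Written with a union of balls, the strip is visibly open for open \<Omega> and monotone
  in \<open>T\<close>.\<close>

definition near_boundary :: "'a::metric_space set \<Rightarrow> real \<Rightarrow> 'a set" where
  "near_boundary \<Omega> T = \<Omega> \<inter> (\<Union>x\<in>frontier \<Omega>. ball x T)"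

text \<open>The data that \<open>lipschitz_boundary\<close> supplies at a single point, fixed so
  that projection and columns can be defined relative to them.\<close>

locale lipschitz_chart =
  fixes \<Omega> :: "(real^'n) set" and x0 e :: "real^'n" and g :: "real^'n \<Rightarrow> real" and L R :: real
  assumes open_dom: "open \<Omega>" and norm_e: "norm e = 1"
    and lip: "L-lipschitz_on {z. z \<bullet> e = 0} g" and R: "0 < R"
    and graph: "\<Omega> \<inter> ball x0 R = {y \<in> ball x0 R. g (y - (y \<bullet> e) *\<^sub>R e) < y \<bullet> e}"
begin

definition pr :: "real^'n \<Rightarrow> real^'n" where
  "pr y = y - (y \<bullet> e) *\<^sub>R e"

lemma e_e: "e \<bullet> e = 1"
  using norm_e by (simp add: norm_eq_1)

lemma pr_orth: "pr y \<bullet> e = 0"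
  by (simp add: pr_def inner_diff_left e_e)

lemma pr_shift: "pr (y + s *\<^sub>R e) = pr y"
  by (simp add: pr_def inner_add_left e_e algebra_simps)

lemma dist_pr_le: "dist (pr x) (pr y) \<le> dist x y"
proof -
  let ?v = "x - y"
  have eq: "pr x - pr y = ?v - (?v \<bullet> e) *\<^sub>R e"
    by (simp add: pr_def inner_diff_left scaleR_diff_left)
  have "(norm (pr x - pr y))\<^sup>2 = (norm ?v)\<^sup>2 - (?v \<bullet> e)\<^sup>2"
    unfolding eq power2_norm_eq_inner
    by (simp add: inner_diff_left inner_diff_right e_e inner_commute power2_eq_square)
  then have "(norm (pr x - pr y))\<^sup>2 \<le> (norm ?v)\<^sup>2" by simp
  then show ?thesis unfolding dist_norm by (rule power2_le_imp_le) simp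
qed

lemma graph_iff: "y \<in> ball x0 R \<Longrightarrow> y \<in> \<Omega> \<longleftrightarrow> g (pr y) < y \<bullet> e"
  using graph unfolding pr_def by blast

lemma continuous_height: "continuous_on UNIV (\<lambda>y. g (pr y))"
proof (rule continuous_on_compose2[OF lipschitz_on_continuous_on[OF lip]])
  show "continuous_on UNIV pr" unfolding pr_def[abs_def] by (intro continuous_intros)
qed (auto simp: pr_orth)

text \<open>A frontier point lies outside the open set \<Omega>, so it is not above the graph; as a
  limit of points of \<Omega> in the chart it is not below the graph either.\<close>

lemma frontier_height:
  assumes "x \<in> frontier \<Omega>" "x \<in> ball x0 R"
  shows "g (pr x) = x \<bullet> e"
proof (rule antisym)
  have "x \<notin> \<Omega>" using assms(1) open_dom by (simp add: frontier_def interior_open)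
  then show "x \<bullet> e \<le> g (pr x)" using graph_iff assms(2) by fastforce
  have x: "x \<in> closure (\<Omega> \<inter> ball x0 R)"
    using assms open_Int_closure_subset[of "ball x0 R" \<Omega>] by (auto simp: frontier_def Int_commute)
  have "closed {y. g (pr y) \<le> y \<bullet> e}"
    by (intro closed_Collect_le continuous_height continuous_intros)
  moreover have "\<Omega> \<inter> ball x0 R \<subseteq> {y. g (pr y) \<le> y \<bullet> e}"
    using graph_iff by (auto intro: less_imp_le)
  ultimately show "g (pr x) \<le> x \<bullet> e"
    using x closure_minimal by blast
qed

text \<open>On the frontier the projection expands back by at most 1 + L, so covers of the projected
  set by balls lift to covers of the boundary set with comparable radii.\<close>

lemma frontier_dist:
  assumes "x \<in> frontier \<Omega>" "x \<in> ball x0 R" "y \<in> frontier \<Omega>" "y \<in> ball x0 R"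
  shows "dist x y \<le> (1 + L) * dist (pr x) (pr y)"
proof -
  have "x = pr x + g (pr x) *\<^sub>R e" "y = pr y + g (pr y) *\<^sub>R e"
    using frontier_height[OF assms(1,2)] frontier_height[OF assms(3,4)] by (simp_all add: pr_def)
  then have "dist x y = norm ((pr x - pr y) + (g (pr x) - g (pr y)) *\<^sub>R e)"
    unfolding dist_norm by (simp add: algebra_simps)
  also have "\<dots> \<le> norm (pr x - pr y) + \<bar>g (pr x) - g (pr y)\<bar>"
    using norm_triangle_ineq[of "pr x - pr y" "(g (pr x) - g (pr y)) *\<^sub>R e"] norm_e by simp
  also have "\<bar>g (pr x) - g (pr y)\<bar> \<le> L * dist (pr x) (pr y)"
    using lipschitz_onD[OF lip, of "pr x" "pr y"] pr_orth by (simp add: dist_real_def)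
  finally show ?thesis by (simp add: dist_norm algebra_simps)
qed

text \<open>The radius is measured after projection, so that disjoint projected balls give disjoint
  columns. The second condition keeps the column over a frontier point inside the strip of width
  2T.\<close>

definition column :: "real^'n \<Rightarrow> real \<Rightarrow> real \<Rightarrow> (real^'n) set" where
  "column x r T = {y \<in> \<Omega>. dist (pr x) (pr y) < r \<and> dist x y < 2 * T}"

lemma open_column: "open (column x r T)"
proof -
  have "continuous_on UNIV pr" unfolding pr_def[abs_def] by (intro continuous_intros)
  then have "open {y. dist (pr x) (pr y) < r}" "open {y. dist x y < 2 * T}"
    by (auto intro!: open_Collect_less continuous_intros)
  moreover have "column x r T = \<Omega> \<inter> {y. dist (pr x) (pr y) < r} \<inter> {y. dist x y < 2 * T}"
    by (auto simp: column_def)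
  ultimately show ?thesis using open_dom by (simp add: open_Int)
qed

text \<open>The translates of \<open>\<Omega> \<inter> ball x r\<close> by multiples of \<open>2 * r\<close> in direction \<open>e\<close> are disjoint, and about
  \<open>T / (2 * r)\<close> of them fit into the column.\<close>

lemma column_estimate:
  fixes w :: "real^'n \<Rightarrow> real"
  assumes w: "integrable lebesgue w"
    and \<beta>: "\<And>V W. open V \<Longrightarrow> V \<subseteq> \<Omega> \<Longrightarrow> W \<in> C1_compact_support V \<Longrightarrow> (\<And>x. norm (W x) \<le> 1) \<Longrightarrow>
       (LINT x:V|lebesgue. w x * divergence W x) \<le> \<beta> V"
    and x: "x \<in> ball x0 (R / 4)" and r: "0 < r" "4 * r \<le> T" and T: "T \<le> R / 4"
  shows "(LINT y:\<Omega> \<inter> ball x r|lebesgue. \<bar>w y\<bar>)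
      \<le> r * (8 / T * (LINT y:column x r T|lebesgue. \<bar>w y\<bar>) + 4 * \<beta> (column x r T))"
proof -
  define Q where "Q = \<Omega> \<inter> ball x r"
  define C where "C = column x r T"
  define Q' where "Q' k = {y. y - (2 * r * real k) *\<^sub>R e \<in> Q}" for k :: nat
  have "open Q" using open_dom by (simp add: Q_def open_Int)
  have "open C" "C \<subseteq> \<Omega>" by (auto simp: C_def open_column) (simp add: column_def)
  \<comment> \<open>Moving upwards from a point above the graph stays above it, and the motion stays
    in the chart: the distance to \<open>x0\<close> is below R/4 + r + T, which is less than
    R.\<close>
  have QC: "y + s *\<^sub>R e \<in> C" if y: "y \<in> Q" and s: "0 \<le> s" "s \<le> T" for y s
  proof -
    have yb: "dist x y < r" "y \<in> \<Omega>" using y by (auto simp: Q_def)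
    have d: "dist y (y + s *\<^sub>R e) = s" using s norm_e by (simp add: dist_norm)
    have "dist x0 (y + s *\<^sub>R e) \<le> dist x0 x + dist x y + dist y (y + s *\<^sub>R e)"
      by (meson dist_triangle order_trans add_right_mono)
    then have b: "y + s *\<^sub>R e \<in> ball x0 R" using d x yb r s T by simp
    have "dist x0 y \<le> dist x0 x + dist x y" by (rule dist_triangle)
    then have yb': "y \<in> ball x0 R" using x yb r T by simp
    have "g (pr y) < y \<bullet> e" using graph_iff[OF yb'] yb by simp
    then have "y + s *\<^sub>R e \<in> \<Omega>"
      using graph_iff[OF b] s by (simp add: pr_shift inner_add_left e_e)
    moreover have "dist (pr x) (pr (y + s *\<^sub>R e)) < r"
      using dist_pr_le[of x y] yb by (simp add: pr_shift)
    moreover have "dist x (y + s *\<^sub>R e) < 2 * T"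
      using dist_triangle[of x "y + s *\<^sub>R e" y] d yb s r by simp
    ultimately show ?thesis by (simp add: C_def column_def)
  qed
  define m where "m = nat \<lfloor>T / (2 * r)\<rfloor>"
  have "2 \<le> T / (2 * r)" using r by (simp add: field_simps)
  then have "real m = of_int \<lfloor>T / (2 * r)\<rfloor>" by (simp add: m_def)
  then have m: "real m \<le> T / (2 * r)" "T / (2 * r) < real m + 1"
    by linarith+
  \<comment> \<open>Since T/(2r) is at least 2, rounding down loses at most half of it.\<close>
  have mT: "T / (4 * r) \<le> real m"
    using m(2) \<open>2 \<le> T / (2 * r)\<close> by (simp add: field_simps)
  have "0 < T / (4 * r)" using r by simp
  with mT have m0: "0 < real m" by linarith
  \<comment> \<open>The slide estimate over height 2rk, always with the same column \<open>C\<close>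
    as \<open>V\<close>.\<close>
  have step: "(LINT y:Q|lebesgue. \<bar>w y\<bar>) \<le> 2 * (LINT y:Q' k|lebesgue. \<bar>w y\<bar>) + 4 * r * \<beta> C"
    if "k \<in> {1..m}" for k
    unfolding Q'_def
  proof (rule slide_estimate[OF w _ norm_e r(1) _ \<open>open C\<close> \<open>open Q\<close>])
    have "2 * r * real k \<le> 2 * r * real m" using that r by (intro mult_left_mono) auto
    also have "\<dots> \<le> T" using m(1) r by (simp add: field_simps)
    finally show "y + s *\<^sub>R e \<in> C" if "y \<in> Q" "0 \<le> s" "s \<le> 2 * r * real k" for y s
      using QC that by simp
  qed (use \<beta> \<open>open C\<close> \<open>C \<subseteq> \<Omega>\<close> r in \<open>auto simp: Q_def\<close>)
  have oQ': "open (Q' k)" for k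
  proof -
    have "open ((\<lambda>y. y - (2 * r * real k) *\<^sub>R e) -` Q)"
      by (intro continuous_open_vimage \<open>open Q\<close>) auto
    then show ?thesis by (simp add: Q'_def vimage_def)
  qed
  have int: "set_integrable lebesgue A (\<lambda>y. \<bar>w y\<bar>)" if "open A" for A
    unfolding set_integrable_def using that w by (intro integrable_mult_indicator) auto
  have disj: "disjoint_family_on Q' {1..m}"
    unfolding disjoint_family_on_def
  proof (intro ballI impI)
    fix k l :: nat assume "k \<noteq> l"
    show "Q' k \<inter> Q' l = {}"
    proof (rule ccontr)
      assume "Q' k \<inter> Q' l \<noteq> {}"
      then obtain y where y: "dist x (y - (2 * r * real k) *\<^sub>R e) < r" "dist x (y - (2 * r * real l) *\<^sub>R e) < r"
        by (auto simp: Q'_def Q_def)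
      have "(y - (2 * r * real k) *\<^sub>R e) - (y - (2 * r * real l) *\<^sub>R e) = (2 * r * (real l - real k)) *\<^sub>R e"
        by (simp add: algebra_simps)
      then have "dist (y - (2 * r * real k) *\<^sub>R e) (y - (2 * r * real l) *\<^sub>R e) = 2 * r * \<bar>real l - real k\<bar>"
        unfolding dist_norm using r norm_e by (simp add: abs_mult)
      moreover have "1 \<le> \<bar>real l - real k\<bar>" using \<open>k \<noteq> l\<close> by linarith
      then have "2 * r * 1 \<le> 2 * r * \<bar>real l - real k\<bar>" using r by (intro mult_left_mono) auto
      ultimately show False
        using y dist_triangle[of "y - (2 * r * real k) *\<^sub>R e" "y - (2 * r * real l) *\<^sub>R e" x]
        by (simp add: dist_commute)
    qed
  qed
  have sub: "(\<Union>k\<in>{1..m}. Q' k) \<subseteq> C"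
  proof
    fix y assume "y \<in> (\<Union>k\<in>{1..m}. Q' k)"
    then obtain k where k: "k \<in> {1..m}" "y - (2 * r * real k) *\<^sub>R e \<in> Q" by (auto simp: Q'_def)
    have "2 * r * real k \<le> 2 * r * real m" using k r by (intro mult_left_mono) auto
    also have "\<dots> \<le> T" using m(1) r by (simp add: field_simps)
    finally show "y \<in> C" using QC[OF k(2), of "2 * r * real k"] r by simp
  qed
  \<comment> \<open>Summing the \<open>m\<close> estimates replaces the translates by their disjoint
    union inside \<open>C\<close>. Dividing by \<open>m\<close> then averages, which produces the
    factor of order r/T in front of the integral over the column.\<close>
  have "real m * (LINT y:Q|lebesgue. \<bar>w y\<bar>) \<le> (\<Sum>k\<in>{1..m}. 2 * (LINT y:Q' k|lebesgue. \<bar>w y\<bar>) + 4 * r * \<beta> C)"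
    using sum_mono[of "{1..m}" "\<lambda>k. LINT y:Q|lebesgue. \<bar>w y\<bar>", OF step] by simp
  also have "\<dots> = 2 * (LINT y:(\<Union>k\<in>{1..m}. Q' k)|lebesgue. \<bar>w y\<bar>) + real m * (4 * r * \<beta> C)"
    using set_integral_finite_Union[OF _ disj, of lebesgue "\<lambda>y. \<bar>w y\<bar>"] int[OF oQ'] oQ'
    by (simp add: sum.distrib sum_distrib_left)
  also have "(LINT y:(\<Union>k\<in>{1..m}. Q' k)|lebesgue. \<bar>w y\<bar>) \<le> (LINT y:C|lebesgue. \<bar>w y\<bar>)"
    unfolding set_lebesgue_integral_def
  proof (rule integral_mono)
    have "open (\<Union>k\<in>{1..m}. Q' k)" using oQ' by blast
    from int[OF this] show "integrable lebesgue (\<lambda>y. indicat_real (\<Union>k\<in>{1..m}. Q' k) y *\<^sub>R \<bar>w y\<bar>)"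
      by (simp add: set_integrable_def)
    show "integrable lebesgue (\<lambda>y. indicat_real C y *\<^sub>R \<bar>w y\<bar>)"
      using int[OF \<open>open C\<close>] by (simp add: set_integrable_def)
  qed (use sub in \<open>auto simp: indicator_def\<close>)
  finally have "(LINT y:Q|lebesgue. \<bar>w y\<bar>) \<le> 2 * (LINT y:C|lebesgue. \<bar>w y\<bar>) / real m + 4 * r * \<beta> C"
    using m0 by (simp add: field_simps)
  \<comment> \<open>With \<open>m\<close> at least T/(4r), the factor 2/m becomes at most
    8r/T.\<close>
  also have "2 * (LINT y:C|lebesgue. \<bar>w y\<bar>) / real m \<le> 2 * (LINT y:C|lebesgue. \<bar>w y\<bar>) / (T / (4 * r))"
    using mT m0 \<open>0 < T / (4 * r)\<close>
    by (intro divide_left_mono mult_pos_pos mult_nonneg_nonneg) (auto simp: set_lebesgue_integral_def intro!: Bochner_Integration.integral_nonneg)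
  finally show ?thesis by (simp add: Q_def C_def algebra_simps)
qed

text \<open>Vitali's lemma is applied to the projected balls, so that the columns over the selected balls, and
  not only the balls themselves, are disjoint.\<close>

lemma cover_bad_set:
  fixes w :: "real^'n \<Rightarrow> real"
  assumes w: "integrable lebesgue w"
    and \<alpha>: "nonneg_borel_measure \<Omega> \<alpha>" and c: "0 \<le> c"
    and \<beta>: "\<And>V W. open V \<Longrightarrow> V \<subseteq> \<Omega> \<Longrightarrow> W \<in> C1_compact_support V \<Longrightarrow> (\<And>x. norm (W x) \<le> 1) \<Longrightarrow>
       (LINT x:V|lebesgue. w x * divergence W x) \<le> c * measure \<alpha> V"
    and B: "B \<subseteq> frontier \<Omega> \<inter> ball x0 (R / 4)"
    and bad: "\<And>x r0. x \<in> B \<Longrightarrow> 0 < r0 \<Longrightarrow>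
       \<exists>r>0. r < r0 \<and> \<epsilon> * r ^ CARD('n) < (LINT y:\<Omega> \<inter> ball x r|lebesgue. \<bar>w y\<bar>)"
    and \<epsilon>: "0 < \<epsilon>" and T: "0 < T" "T \<le> R / 4" and \<delta>: "0 < \<delta>"
  shows "\<exists>C :: nat \<Rightarrow> (real^'n) set. B \<subseteq> (\<Union>i. C i) \<and> (\<forall>i. bounded (C i) \<and> diameter (C i) \<le> \<delta>) \<and>
     (\<Sum>i. cover_weight (CARD('n) - 1) (C i)) \<le> ennreal
        (unit_ball_vol (real (CARD('n) - 1)) * (5 * (1 + L)) ^ (CARD('n) - 1) / \<epsilon> *
          (8 / T * (LINT y|lebesgue. \<bar>w y\<bar>) + 4 * (c * measure \<alpha> (near_boundary \<Omega> (2 * T)))))"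
proof -
  have L: "0 \<le> L" using lip by (simp add: lipschitz_on_def)
  define d where "d = CARD('n) - 1"
  have d: "CARD('n) = Suc d" by (simp add: d_def)
  interpret \<alpha>: finite_measure \<alpha> using \<alpha> by (simp add: nonneg_borel_measure_def)
  have sets\<alpha>: "A \<in> sets \<alpha>" if "open A" "A \<subseteq> \<Omega>" for A
    using \<alpha> that open_dom by (auto simp: nonneg_borel_measure_def sets_restrict_space_iff)
  \<comment> \<open>The first bound makes \<open>column_estimate\<close> applicable; the second
    keeps the diameter of a ball of radius 5(1 + L)r below \<delta>.\<close>
  define r0 where "r0 = min (T / 4) (\<delta> / (10 * (1 + L)))"
  have r0: "0 < r0" using T \<delta> L by (simp add: r0_def)
  have "\<forall>x\<in>B. \<exists>r>0. r < r0 \<and> \<epsilon> * r ^ CARD('n) < (LINT y:\<Omega> \<inter> ball x r|lebesgue. \<bar>w y\<bar>)"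
    using bad r0 by blast
  then obtain r where r: "\<And>x. x \<in> B \<Longrightarrow> 0 < r x" "\<And>x. x \<in> B \<Longrightarrow> r x < r0"
    "\<And>x. x \<in> B \<Longrightarrow> \<epsilon> * r x ^ CARD('n) < (LINT y:\<Omega> \<inter> ball x (r x)|lebesgue. \<bar>w y\<bar>)"
    by metis
  have "0 < r x \<and> r x \<le> r0" if "x \<in> B" for x using r that by (auto intro: less_imp_le)
  \<comment> \<open>The centres are \<open>pr i\<close>, while the index set stays in
    \<open>B\<close>: each selected ball remembers its boundary point.\<close>
  from Vitali_covering_lemma_cballs_balls[of B r r0 pr, OF this]
  obtain J where J: "countable J" "J \<subseteq> B"
    "pairwise (\<lambda>i j. disjnt (cball (pr i) (r i)) (cball (pr j) (r j))) J"
    "\<And>i. i \<in> B \<Longrightarrow> \<exists>j. j \<in> J \<and> \<not> disjnt (cball (pr i) (r i)) (cball (pr j) (r j)) \<and>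
        cball (pr i) (r i) \<subseteq> ball (pr j) (5 * r j)" by blast
  define K where "K x = column x (r x) T" for x
  have KO: "open (K x)" "K x \<subseteq> \<Omega>" for x by (auto simp: K_def open_column) (simp add: column_def)
  \<comment> \<open>Badness supplies the power \<open>Suc d\<close> of the radius and
    \<open>column_estimate\<close> a single factor of it. Cancelling that factor leaves the power
    belonging to a set of codimension one.\<close>
  have K: "r x ^ d \<le> (8 / T * (LINT y:K x|lebesgue. \<bar>w y\<bar>) + 4 * (c * measure \<alpha> (K x))) / \<epsilon>"
    if x: "x \<in> B" for x
  proof -
    have "\<epsilon> * r x ^ CARD('n) < (LINT y:\<Omega> \<inter> ball x (r x)|lebesgue. \<bar>w y\<bar>)" using r x by blast
    also have "\<dots> \<le> r x * (8 / T * (LINT y:K x|lebesgue. \<bar>w y\<bar>) + 4 * (c * measure \<alpha> (K x)))"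
      unfolding K_def
      by (rule column_estimate[OF w \<beta>]) (use x B r[OF x] T in \<open>auto simp: r0_def\<close>)
    finally have "r x * (\<epsilon> * r x ^ d) < r x * (8 / T * (LINT y:K x|lebesgue. \<bar>w y\<bar>) + 4 * (c * measure \<alpha> (K x)))"
      unfolding d by (simp add: algebra_simps)
    then have "\<epsilon> * r x ^ d < 8 / T * (LINT y:K x|lebesgue. \<bar>w y\<bar>) + 4 * (c * measure \<alpha> (K x))"
      using r(1)[OF x] mult_less_cancel_left_pos by blast
    then show ?thesis using \<epsilon> by (simp only: pos_le_divide_eq) (simp add: mult.commute)
  qed
  have Kdisj: "disjoint_family_on K J"
    unfolding disjoint_family_on_def
  proof (intro ballI impI)
    fix i j assume "i \<in> J" "j \<in> J" "i \<noteq> j"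
    then have "disjnt (cball (pr i) (r i)) (cball (pr j) (r j))" using J(3) by (simp add: pairwise_def)
    moreover have "pr y \<in> cball (pr i) (r i)" if "y \<in> K i" for y i
      using that by (simp add: K_def column_def)
    ultimately show "K i \<inter> K j = {}" unfolding disjnt_def by blast
  qed
  have Knear: "K x \<subseteq> near_boundary \<Omega> (2 * T)" if "x \<in> J" for x
  proof -
    have "x \<in> frontier \<Omega>" using that J(2) B by blast
    then show ?thesis unfolding K_def column_def near_boundary_def by auto
  qed
  have near: "open (near_boundary \<Omega> (2 * T))" "near_boundary \<Omega> (2 * T) \<subseteq> \<Omega>"
    using open_dom unfolding near_boundary_def by auto
  have int: "set_integrable lebesgue A (\<lambda>y. \<bar>w y\<bar>)" if "open A" for A
    unfolding set_integrable_def using that w by (intro integrable_mult_indicator) auto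
  define X where "X = 8 / T * (LINT y|lebesgue. \<bar>w y\<bar>) + 4 * (c * measure \<alpha> (near_boundary \<Omega> (2 * T)))"
  \<comment> \<open>Disjoint columns inside the strip: their integrals and their \<alpha>-masses add
    up to at most the totals.\<close>
  have total: "(\<Sum>x\<in>F. r x ^ d) \<le> X / \<epsilon>" if F: "finite F" "F \<subseteq> J" for F
  proof -
    have dF: "disjoint_family_on K F" using Kdisj F(2) by (rule disjoint_family_on_mono[rotated])
    have "(\<Sum>x\<in>F. LINT y:K x|lebesgue. \<bar>w y\<bar>) = (LINT y:(\<Union>x\<in>F. K x)|lebesgue. \<bar>w y\<bar>)"
      using set_integral_finite_Union[OF F(1) dF, of lebesgue "\<lambda>y. \<bar>w y\<bar>"] int[OF KO(1)] KO(1) by simp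
    also have "\<dots> \<le> (LINT y|lebesgue. \<bar>w y\<bar>)"
      unfolding set_lebesgue_integral_def
    proof (rule integral_mono)
      have "open (\<Union>x\<in>F. K x)" using KO by blast
      from int[OF this] show "integrable lebesgue (\<lambda>y. indicat_real (\<Union>x\<in>F. K x) y *\<^sub>R \<bar>w y\<bar>)"
        by (simp add: set_integrable_def)
    qed (use w in \<open>auto simp: indicator_def\<close>)
    finally have 1: "(\<Sum>x\<in>F. LINT y:K x|lebesgue. \<bar>w y\<bar>) \<le> (LINT y|lebesgue. \<bar>w y\<bar>)" .
    have "(\<Sum>x\<in>F. measure \<alpha> (K x)) = measure \<alpha> (\<Union>x\<in>F. K x)"
      using F(1) dF sets\<alpha>[OF KO] by (intro \<alpha>.finite_measure_finite_Union[symmetric]) auto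
    also have "\<dots> \<le> measure \<alpha> (near_boundary \<Omega> (2 * T))"
      using Knear F(2) by (intro \<alpha>.finite_measure_mono sets\<alpha> near) blast
    finally have 2: "(\<Sum>x\<in>F. measure \<alpha> (K x)) \<le> measure \<alpha> (near_boundary \<Omega> (2 * T))" .
    have "(\<Sum>x\<in>F. r x ^ d) \<le> (\<Sum>x\<in>F. (8 / T * (LINT y:K x|lebesgue. \<bar>w y\<bar>) + 4 * (c * measure \<alpha> (K x))) / \<epsilon>)"
      using K F J(2) by (intro sum_mono) auto
    also have "\<dots> = (8 / T * (\<Sum>x\<in>F. LINT y:K x|lebesgue. \<bar>w y\<bar>) + 4 * (c * (\<Sum>x\<in>F. measure \<alpha> (K x)))) / \<epsilon>"
      by (simp only: sum_divide_distrib[symmetric] sum.distrib sum_distrib_left)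
    also have "\<dots> \<le> X / \<epsilon>"
      unfolding X_def using 1 2 T \<epsilon> c
      by (intro divide_right_mono add_mono mult_left_mono) auto
    finally show ?thesis .
  qed
  \<comment> \<open>The radii are enlarged by 5 from Vitali's lemma and by 1 + L from
    \<open>frontier_dist\<close>.\<close>
  have "\<exists>C :: nat \<Rightarrow> (real^'n) set. B \<subseteq> (\<Union>i. C i) \<and> (\<forall>i. bounded (C i) \<and> diameter (C i) \<le> \<delta>) \<and>
     (\<Sum>i. cover_weight d (C i)) \<le> ennreal
        (unit_ball_vol (real d) * (5 * (1 + L)) ^ d * (X / \<epsilon>))"
  proof (rule ball_cover_sum_le[OF J(1), where c = "\<lambda>x. x" and \<rho> = "\<lambda>x. 5 * (1 + L) * r x"])
    show "B \<subseteq> (\<Union>j\<in>J. ball j (5 * (1 + L) * r j))"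
    proof
      fix y assume y: "y \<in> B"
      then obtain j where j: "j \<in> J" "cball (pr y) (r y) \<subseteq> ball (pr j) (5 * r j)" using J(4) by blast
      have "pr y \<in> cball (pr y) (r y)" using r(1)[OF y] by simp
      then have "dist (pr j) (pr y) < 5 * r j" using j(2) by (meson mem_ball subsetD)
      then have "(1 + L) * dist (pr j) (pr y) < (1 + L) * (5 * r j)"
        using L by (intro mult_strict_left_mono) auto
      moreover have "dist j y \<le> (1 + L) * dist (pr j) (pr y)"
      proof (rule frontier_dist)
        have "y \<in> B" "j \<in> B" using y j(1) J(2) by auto
        then have "y \<in> frontier \<Omega> \<inter> ball x0 (R / 4)" "j \<in> frontier \<Omega> \<inter> ball x0 (R / 4)" using B by auto
        then show "j \<in> frontier \<Omega>" "j \<in> ball x0 R" "y \<in> frontier \<Omega>" "y \<in> ball x0 R"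
          using R by auto
      qed
      ultimately have "dist j y < 5 * (1 + L) * r j" by (simp add: algebra_simps)
      then show "y \<in> (\<Union>j\<in>J. ball j (5 * (1 + L) * r j))" using j(1) by auto
    qed
    show "0 < 5 * (1 + L) * r j \<and> 2 * (5 * (1 + L) * r j) \<le> \<delta>" if "j \<in> J" for j
    proof -
      have "r j \<le> \<delta> / (10 * (1 + L))" "0 < r j"
        using r(1,2)[of j] that J(2) by (auto simp: r0_def)
      then show ?thesis using L by (intro conjI mult_pos_pos) (simp_all add: field_simps)
    qed
    show "(\<Sum>j\<in>F. unit_ball_vol (real d) * (5 * (1 + L) * r j) ^ d)
        \<le> unit_ball_vol (real d) * (5 * (1 + L)) ^ d * (X / \<epsilon>)" if "finite F" "F \<subseteq> J" for F
    proof -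
      have "(\<Sum>j\<in>F. unit_ball_vol (real d) * (5 * (1 + L) * r j) ^ d)
        = unit_ball_vol (real d) * (5 * (1 + L)) ^ d * (\<Sum>j\<in>F. r j ^ d)"
        by (simp only: power_mult_distrib sum_distrib_left mult.assoc)
      also have "\<dots> \<le> unit_ball_vol (real d) * (5 * (1 + L)) ^ d * (X / \<epsilon>)"
        using total[OF that] L by (intro mult_left_mono mult_nonneg_nonneg) auto
      finally show ?thesis .
    qed
  qed (rule \<delta>)
  then show ?thesis by (simp add: d_def X_def)
qed

end

section \<open>Passage of vanishing traces to the limit\<close>

lemma near_boundary_measure_tendsto_0:
  fixes \<Omega> :: "(real^'n) set"
  assumes "open \<Omega>" and \<alpha>: "nonneg_borel_measure \<Omega> \<alpha>"
  shows "(\<lambda>k. measure \<alpha> (near_boundary \<Omega> (1 / real (Suc k)))) \<longlonglongrightarrow> 0"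
proof -
  interpret \<alpha>: finite_measure \<alpha> using \<alpha> by (simp add: nonneg_borel_measure_def)
  let ?A = "\<lambda>k. near_boundary \<Omega> (1 / real (Suc k))"
  have "open (?A k)" "?A k \<subseteq> \<Omega>" for k
    using assms(1) by (auto simp: near_boundary_def)
  then have "range ?A \<subseteq> sets \<alpha>"
    using \<alpha> assms(1) by (auto simp: nonneg_borel_measure_def sets_restrict_space_iff)
  moreover have "decseq ?A"
    unfolding decseq_def
  proof (intro allI impI)
    fix m n :: nat assume "m \<le> n"
    then have "1 / real (Suc n) \<le> 1 / real (Suc m)" by (simp add: frac_le)
    then have "ball x (1 / real (Suc n)) \<subseteq> ball x (1 / real (Suc m))" for x :: "real^'n"
      by (rule subset_ball)
    then show "?A n \<subseteq> ?A m" unfolding near_boundary_def by blast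
  qed
  ultimately have "(\<lambda>k. measure \<alpha> (?A k)) \<longlonglongrightarrow> measure \<alpha> (\<Inter>k. ?A k)"
    by (rule \<alpha>.finite_Lim_measure_decseq)
  \<comment> \<open>A point of \<Omega> has a ball inside \<Omega>, which contains no frontier
    point, so it leaves the strips once their width is below the radius. Continuity from above of
    the finite measure \<alpha> then gives the limit.\<close>
  moreover have "(\<Inter>k. ?A k) = {}"
  proof -
    have "y \<notin> (\<Inter>k. ?A k)" for y
    proof (cases "y \<in> \<Omega>")
      case True
      then obtain \<rho> where \<rho>: "0 < \<rho>" "ball y \<rho> \<subseteq> \<Omega>" using assms(1) open_contains_ball by blast
      obtain k where k: "1 / real (Suc k) < \<rho>" using \<rho>(1) nat_approx_posE by blast
      have "frontier \<Omega> \<inter> \<Omega> = {}" using assms(1) by (simp add: frontier_disjoint_eq)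
      moreover have "x \<in> \<Omega>" if "y \<in> ball x (1 / real (Suc k))" for x
        using that \<rho>(2) k by (intro subsetD[OF \<rho>(2)]) (simp add: dist_commute del: of_nat_Suc)
      ultimately have "y \<notin> ?A k" unfolding near_boundary_def by blast
      then show ?thesis unfolding INT_iff by blast
    next
      case False
      then have "y \<notin> ?A 0" by (simp add: near_boundary_def)
      then show ?thesis unfolding INT_iff by blast
    qed
    then show ?thesis by blast
  qed
  ultimately show ?thesis by simp
qed

text \<open>A point where the trace of \<open>u\<close> fails to vanish belongs to some
  \<open>B j\<close>. Since \<open>v n\<close> has zero trace there, \<open>u - v n\<close> is still
  bad at level \<epsilon> j, so \<open>cover_bad_set\<close> bounds the content of
  \<open>B j\<close> for every \<open>n\<close> and every width.\<close>

lemma (in lipschitz_chart) zero_trace_limit_local: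
  fixes u :: "real^'n \<Rightarrow> real" and v :: "nat \<Rightarrow> real^'n \<Rightarrow> real"
  assumes u: "integrable lebesgue u" and v: "\<And>n. integrable lebesgue (v n)"
    and \<alpha>: "nonneg_borel_measure \<Omega> \<alpha>" and c: "0 \<le> c"
    and \<beta>: "\<And>n V W. open V \<Longrightarrow> V \<subseteq> \<Omega> \<Longrightarrow> W \<in> C1_compact_support V \<Longrightarrow> (\<And>x. norm (W x) \<le> 1) \<Longrightarrow>
       (LINT x:V|lebesgue. (u x - v n x) * divergence W x) \<le> c * measure \<alpha> V"
    and lim: "(\<lambda>n. LINT x|lebesgue. \<bar>u x - v n x\<bar>) \<longlonglongrightarrow> 0"
    and D: "D \<subseteq> frontier \<Omega> \<inter> ball x0 (R / 4)"
    and tr: "\<And>n x. x \<in> D \<Longrightarrow> has_trace_at \<Omega> (v n) x 0"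
  shows "hausdorff_measure (CARD('n) - 1) {x \<in> D. \<not> has_trace_at \<Omega> u x 0} = 0"
proof -
  define \<epsilon> where "\<epsilon> j = 1 / real (Suc j)" for j
  have \<epsilon>: "0 < \<epsilon> j" for j by (simp add: \<epsilon>_def)
  \<comment> \<open>The factor 2 leaves room to lose \<epsilon> j to \<open>v n\<close>. Levels
    indexed by naturals keep the union countable.\<close>
  define B where "B j = {x \<in> D. \<forall>r0>0. \<exists>r>0. r < r0 \<and>
      2 * \<epsilon> j * r ^ CARD('n) < (LINT y:\<Omega> \<inter> ball x r|lebesgue. \<bar>u y\<bar>)}" for j
  have bad: "x \<in> (\<Union>j. B j)" if x: "x \<in> D" "\<not> has_trace_at \<Omega> u x 0" for x
  proof -
    let ?q = "\<lambda>r. (LINT y:\<Omega> \<inter> ball x r|lebesgue. \<bar>u y\<bar>) / r ^ CARD('n)"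
    obtain \<eta> where \<eta>: "0 < \<eta>" "\<not> eventually (\<lambda>r. dist (?q r) 0 < \<eta>) (at_right 0)"
      using x(2) unfolding has_trace_at_def tendsto_iff by auto
    obtain j where j: "\<epsilon> j < \<eta> / 2"
      unfolding \<epsilon>_def using \<eta>(1) nat_approx_posE[of "\<eta> / 2"] by auto
    have "\<exists>r>0. r < r0 \<and> 2 * \<epsilon> j * r ^ CARD('n) < (LINT y:\<Omega> \<inter> ball x r|lebesgue. \<bar>u y\<bar>)"
      if "0 < r0" for r0
    proof -
      obtain r where r: "0 < r" "r < r0" "\<not> dist (?q r) 0 < \<eta>"
        using \<eta>(2) \<open>0 < r0\<close> unfolding eventually_at_right_field by blast
      have "0 \<le> ?q r"
        using r(1) by (auto simp: set_lebesgue_integral_def intro!: divide_nonneg_nonneg Bochner_Integration.integral_nonneg)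
      then have "2 * \<epsilon> j < ?q r" using r(3) j by (simp add: dist_real_def)
      then have "2 * \<epsilon> j * r ^ CARD('n) < (LINT y:\<Omega> \<inter> ball x r|lebesgue. \<bar>u y\<bar>)"
        using r(1) by (simp add: pos_less_divide_eq)
      then show ?thesis using r by blast
    qed
    then have "x \<in> B j" using x(1) by (simp add: B_def)
    then show ?thesis by blast
  qed
  have bad_diff: "\<exists>r>0. r < r0 \<and> \<epsilon> j * r ^ CARD('n) < (LINT y:\<Omega> \<inter> ball x r|lebesgue. \<bar>u y - v n y\<bar>)"
    if x: "x \<in> B j" and "0 < r0" for x j n r0
  proof -
    have "x \<in> D" using x by (simp add: B_def)
    from tr[OF this, of n] have "eventually (\<lambda>r. dist ((LINT y:\<Omega> \<inter> ball x r|lebesgue. \<bar>v n y\<bar>) / r ^ CARD('n)) 0 < \<epsilon> j) (at_right 0)"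
      unfolding has_trace_at_def tendsto_iff using \<epsilon>[of j] by auto
    then obtain b where b: "0 < b"
      "\<And>r. 0 < r \<Longrightarrow> r < b \<Longrightarrow> dist ((LINT y:\<Omega> \<inter> ball x r|lebesgue. \<bar>v n y\<bar>) / r ^ CARD('n)) 0 < \<epsilon> j"
      unfolding eventually_at_right_field by blast
    have "0 < min r0 b" using b(1) \<open>0 < r0\<close> by simp
    then obtain r where r: "0 < r" "r < min r0 b"
      "2 * \<epsilon> j * r ^ CARD('n) < (LINT y:\<Omega> \<inter> ball x r|lebesgue. \<bar>u y\<bar>)"
      using x unfolding B_def by blast
    let ?Q = "\<Omega> \<inter> ball x r"
    have Q: "?Q \<in> sets lebesgue" using open_dom by (auto intro: open_Int)
    have int: "set_integrable lebesgue ?Q (\<lambda>y. \<bar>h y\<bar>)" if "integrable lebesgue h" for h :: "real^'n \<Rightarrow> real"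
      unfolding set_integrable_def using that Q by (intro integrable_mult_indicator) auto
    have "(LINT y:?Q|lebesgue. \<bar>v n y\<bar>) / r ^ CARD('n) < \<epsilon> j"
      using b(2)[of r] r(1,2) unfolding dist_real_def by linarith
    then have 1: "(LINT y:?Q|lebesgue. \<bar>v n y\<bar>) < \<epsilon> j * r ^ CARD('n)"
      using r(1) by (simp add: pos_divide_less_eq)
    have "(LINT y:?Q|lebesgue. \<bar>u y\<bar>) \<le> (LINT y:?Q|lebesgue. \<bar>u y - v n y\<bar> + \<bar>v n y\<bar>)"
      by (intro set_integral_mono set_integral_add int u v Bochner_Integration.integrable_diff) auto
    also have "\<dots> = (LINT y:?Q|lebesgue. \<bar>u y - v n y\<bar>) + (LINT y:?Q|lebesgue. \<bar>v n y\<bar>)"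
      by (intro set_integral_add int u v Bochner_Integration.integrable_diff)
    finally have "\<epsilon> j * r ^ CARD('n) < (LINT y:?Q|lebesgue. \<bar>u y - v n y\<bar>)"
      using r(3) 1 by simp
    then show ?thesis using r by auto
  qed
  have null: "hausdorff_measure (CARD('n) - 1) (B j) = 0" for j
    unfolding hausdorff_measure_eq_0_iff
  proof (intro allI impI)
    fix \<delta> \<eta> :: real assume \<delta>: "0 < \<delta>" and \<eta>: "0 < \<eta>"
    define A where "A = unit_ball_vol (real (CARD('n) - 1)) * (5 * (1 + L)) ^ (CARD('n) - 1) / \<epsilon> j"
    have "0 \<le> L" using lip by (simp add: lipschitz_on_def)
    then have A: "0 \<le> A" using \<epsilon>[of j] by (simp add: A_def)
    \<comment> \<open>The width is chosen before \<open>n\<close>: the mass of the strip does not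
      depend on \<open>n\<close>, whereas the integral term carries the factor 8/T.\<close>
    have "(\<lambda>k. A * (4 * (c * measure \<alpha> (near_boundary \<Omega> (1 / real (Suc k)))))) \<longlonglongrightarrow> A * (4 * (c * 0))"
      by (intro tendsto_intros near_boundary_measure_tendsto_0 open_dom \<alpha>)
    then have "eventually (\<lambda>k. A * (4 * (c * measure \<alpha> (near_boundary \<Omega> (1 / real (Suc k))))) < \<eta> / 2) sequentially"
      using \<eta> by (intro order_tendstoD(2)) auto
    moreover have "eventually (\<lambda>k. 1 / real (Suc k) < R / 2) sequentially"
      using R by (intro order_tendstoD(2)[OF LIMSEQ_Suc[OF lim_const_over_n, of 1]]) auto
    ultimately have "eventually (\<lambda>k. A * (4 * (c * measure \<alpha> (near_boundary \<Omega> (1 / real (Suc k))))) < \<eta> / 2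
        \<and> 1 / real (Suc k) < R / 2) sequentially"
      by (rule eventually_conj)
    then obtain k where k: "A * (4 * (c * measure \<alpha> (near_boundary \<Omega> (1 / real (Suc k))))) < \<eta> / 2"
        "1 / real (Suc k) < R / 2"
      using eventually_happens'[OF sequentially_bot] by blast
    \<comment> \<open>Half of 1/(k+1), because the estimate involves the strip of width 2T.\<close>
    define T where "T = 1 / real (Suc k) / 2"
    have T: "0 < T" "T \<le> R / 4" "2 * T = 1 / real (Suc k)" using k(2) by (simp_all add: T_def del: of_nat_Suc)
    \<comment> \<open>With \<open>T\<close> fixed, L^1 convergence makes the remaining term
      small.\<close>
    have "(\<lambda>n. A * (8 / T * (LINT x|lebesgue. \<bar>u x - v n x\<bar>))) \<longlonglongrightarrow> A * (8 / T * 0)"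
      by (intro tendsto_intros lim)
    then have "eventually (\<lambda>n. A * (8 / T * (LINT x|lebesgue. \<bar>u x - v n x\<bar>)) < \<eta> / 2) sequentially"
      using \<eta> by (intro order_tendstoD(2)) auto
    then obtain n where n: "A * (8 / T * (LINT x|lebesgue. \<bar>u x - v n x\<bar>)) < \<eta> / 2"
      using eventually_happens'[OF sequentially_bot] by blast
    have BD: "B j \<subseteq> frontier \<Omega> \<inter> ball x0 (R / 4)" using D by (auto simp: B_def)
    have "\<exists>C :: nat \<Rightarrow> (real^'n) set. B j \<subseteq> (\<Union>i. C i) \<and> (\<forall>i. bounded (C i) \<and> diameter (C i) \<le> \<delta>) \<and>
      (\<Sum>i. cover_weight (CARD('n) - 1) (C i)) \<le> ennreal
          (A * (8 / T * (LINT y|lebesgue. \<bar>u y - v n y\<bar>) + 4 * (c * measure \<alpha> (near_boundary \<Omega> (2 * T)))))"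
      unfolding A_def
    proof (rule cover_bad_set)
      show "integrable lebesgue (\<lambda>y. u y - v n y)" by (rule Bochner_Integration.integrable_diff[OF u v])
      show "(LINT x:V|lebesgue. (u x - v n x) * divergence W x) \<le> c * measure \<alpha> V"
        if "open V" "V \<subseteq> \<Omega>" "W \<in> C1_compact_support V" "\<And>x. norm (W x) \<le> 1" for V W
        using that by (rule \<beta>)
    qed (fact \<alpha> c \<epsilon> T \<delta> BD | rule bad_diff, assumption, assumption)+
    then obtain C :: "nat \<Rightarrow> (real^'n) set" where C: "B j \<subseteq> (\<Union>i. C i) \<and> (\<forall>i. bounded (C i) \<and> diameter (C i) \<le> \<delta>) \<and>
      (\<Sum>i. cover_weight (CARD('n) - 1) (C i)) \<le> ennreal
          (A * (8 / T * (LINT y|lebesgue. \<bar>u y - v n y\<bar>) + 4 * (c * measure \<alpha> (near_boundary \<Omega> (2 * T)))))" ..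
    have "A * (8 / T * (LINT y|lebesgue. \<bar>u y - v n y\<bar>) + 4 * (c * measure \<alpha> (near_boundary \<Omega> (2 * T)))) \<le> \<eta>"
      using n k(1) unfolding T(3) distrib_left by linarith
    from ennreal_leI[OF this] C show "\<exists>C. B j \<subseteq> (\<Union>i. C i) \<and> (\<forall>i. bounded (C i) \<and> diameter (C i) \<le> \<delta>) \<and>
       (\<Sum>i. cover_weight (CARD('n) - 1) (C i)) \<le> ennreal \<eta>"
      by (intro exI[of _ C]) (auto intro: order_trans)
  qed
  have "hausdorff_measure (CARD('n) - 1) (\<Union>j. B j) = 0"
    using null by (rule hausdorff_measure_0_UN)
  then show ?thesis
    by (rule hausdorff_measure_0_subset) (use bad in blast)
qed

text \<open>The exceptional sets of all \<open>v n\<close> are merged into one null set, outside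
  which every \<open>v n\<close> has zero trace. Compactness of the frontier reduces the claim to
  finitely many charts.\<close>

lemma zero_trace_limit:
  fixes u :: "real^'n \<Rightarrow> real" and v :: "nat \<Rightarrow> real^'n \<Rightarrow> real"
  assumes \<Omega>: "bounded_lipschitz_domain \<Omega>"
    and u: "integrable lebesgue u" and v: "\<And>n. integrable lebesgue (v n)"
    and \<alpha>: "nonneg_borel_measure \<Omega> \<alpha>" and c: "0 \<le> c"
    and \<beta>: "\<And>n V W. open V \<Longrightarrow> V \<subseteq> \<Omega> \<Longrightarrow> W \<in> C1_compact_support V \<Longrightarrow> (\<And>x. norm (W x) \<le> 1) \<Longrightarrow>
       (LINT x:V|lebesgue. (u x - v n x) * divergence W x) \<le> c * measure \<alpha> V"
    and lim: "(\<lambda>n. LINT x|lebesgue. \<bar>u x - v n x\<bar>) \<longlonglongrightarrow> 0"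
    and D: "D \<subseteq> frontier \<Omega>"
    and tr: "\<And>n. \<exists>N. hausdorff_measure (CARD('n) - 1) N = 0 \<and> (\<forall>x\<in>D - N. has_trace_at \<Omega> (v n) x 0)"
  shows "\<exists>N. hausdorff_measure (CARD('n) - 1) N = 0 \<and> (\<forall>x\<in>D - N. has_trace_at \<Omega> u x 0)"
proof -
  have "open \<Omega>" "bounded \<Omega>" "lipschitz_boundary \<Omega>" using \<Omega> by (auto simp: bounded_lipschitz_domain_def)
  obtain N where N: "\<And>n. hausdorff_measure (CARD('n) - 1) (N n) = 0"
      "\<And>n x. x \<in> D - N n \<Longrightarrow> has_trace_at \<Omega> (v n) x 0"
    using tr by metis
  define N0 where "N0 = (\<Union>n. N n)"
  have N0: "hausdorff_measure (CARD('n) - 1) N0 = 0"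
    unfolding N0_def using N(1) by (rule hausdorff_measure_0_UN)
  have "\<exists>\<rho>>0. hausdorff_measure (CARD('n) - 1) {x \<in> (D - N0) \<inter> ball x0 \<rho>. \<not> has_trace_at \<Omega> u x 0} = 0"
    if x0: "x0 \<in> frontier \<Omega>" for x0
  proof -
    have "\<exists>e g L R. lipschitz_chart \<Omega> x0 e g L R"
      using bspec[OF \<open>lipschitz_boundary \<Omega>\<close>[unfolded lipschitz_boundary_def] x0] \<open>open \<Omega>\<close>
      unfolding lipschitz_chart_def by simp
    then obtain e g L R where "lipschitz_chart \<Omega> x0 e g L R" by blast
    then interpret lipschitz_chart \<Omega> x0 e g L R .
    have "hausdorff_measure (CARD('n) - 1) {x \<in> (D - N0) \<inter> ball x0 (R / 4). \<not> has_trace_at \<Omega> u x 0} = 0"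
      by (rule zero_trace_limit_local[OF u v \<alpha> c \<beta> lim])
         (use D N(2) in \<open>auto simp: N0_def\<close>)
    then show ?thesis using R by (intro exI[of _ "R / 4"]) auto
  qed
  then have "\<forall>x0\<in>frontier \<Omega>. \<exists>\<rho>. 0 < \<rho> \<and>
      hausdorff_measure (CARD('n) - 1) {x \<in> (D - N0) \<inter> ball x0 \<rho>. \<not> has_trace_at \<Omega> u x 0} = 0"
    by blast
  from bchoice[OF this] obtain \<rho> where \<rho>': "\<forall>x0\<in>frontier \<Omega>. 0 < \<rho> x0 \<and>
      hausdorff_measure (CARD('n) - 1) {x \<in> (D - N0) \<inter> ball x0 (\<rho> x0). \<not> has_trace_at \<Omega> u x 0} = 0" ..
  note \<rho> = bspec[OF \<rho>', THEN conjunct1] bspec[OF \<rho>', THEN conjunct2]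
  have "compact (frontier \<Omega>)" using \<open>bounded \<Omega>\<close> by (rule compact_frontier_bounded)
  then obtain F where F: "F \<subseteq> frontier \<Omega>" "finite F" "frontier \<Omega> \<subseteq> (\<Union>x\<in>F. ball x (\<rho> x))"
  proof (rule compactE_image[of _ "frontier \<Omega>" "\<lambda>x. ball x (\<rho> x)"])
    show "frontier \<Omega> \<subseteq> (\<Union>x\<in>frontier \<Omega>. ball x (\<rho> x))" using \<rho>(1) by auto
  qed auto
  define E where "E x0 = {x \<in> (D - N0) \<inter> ball x0 (\<rho> x0). \<not> has_trace_at \<Omega> u x 0}" for x0
  have "hausdorff_measure (CARD('n) - 1) (\<Union>x\<in>F. E x) = 0"
    using F(1,2) \<rho>(2) unfolding E_def by (intro hausdorff_measure_0_countable_UN countable_finite) auto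
  then have "hausdorff_measure (CARD('n) - 1) (\<Union>i\<in>{True, False}. if i then N0 else (\<Union>x\<in>F. E x)) = 0"
    using N0 by (intro hausdorff_measure_0_countable_UN) auto
  then have "hausdorff_measure (CARD('n) - 1) (N0 \<union> (\<Union>x\<in>F. E x)) = 0"
    by (simp add: Un_commute)
  moreover have "has_trace_at \<Omega> u x 0" if x: "x \<in> D - (N0 \<union> (\<Union>x\<in>F. E x))" for x
  proof -
    obtain x0 where "x0 \<in> F" "x \<in> ball x0 (\<rho> x0)" using x D F(3) by blast
    then show ?thesis using x by (auto simp: E_def)
  qed
  ultimately show ?thesis by blast
qed

subsection \<open>The variation constraint\<close>

text \<open>In \<open>ennreal\<close> the denominator \<open>1 - 1 / p\<close> never exceeds 1. The
  bound makes the dual norm comparable with the Euclidean one.\<close>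

lemma conjugate_exponent_ge_1: "1 \<le> conjugate_exponent p"
proof -
  have "1 \<le> 1 / y" if "y \<le> 1" for y :: ennreal
  proof (cases y)
    case (real r)
    then have "r \<le> 1" using that by simp
    then show ?thesis
      using real by (cases "r = 0") (auto simp: divide_ennreal simp flip: ennreal_1)
  qed (use that in \<open>simp add: top_unique\<close>)
  then show ?thesis by (simp add: conjugate_exponent_def)
qed

text \<open>The crude factor CARD('n) serves all exponents at once. This comparison and its converse
  enter only through constants in front of \<alpha>.\<close>

lemma lp_norm_le_norm:
  fixes x :: "real^'n"
  assumes "1 \<le> q"
  shows "lp_norm q x \<le> real CARD('n) * norm x"
proof (cases q)
  case top
  have "infnorm x \<le> 1 * norm x" using infnorm_le_norm[of x] by simp
  also have "1 * norm x \<le> real CARD('n) * norm x"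
    by (intro mult_right_mono) (simp_all add: Suc_leI)
  finally show ?thesis using top by (simp add: lp_norm_def)
next
  case (real t)
  then have t: "1 \<le> t" using assms by simp
  have "(\<Sum>i\<in>UNIV. \<bar>x $ i\<bar> powr t) \<le> (\<Sum>i\<in>(UNIV::'n set). norm x powr t)"
    using t by (intro sum_mono powr_mono2) (auto simp: component_le_norm_cart)
  then have "(\<Sum>i\<in>UNIV. \<bar>x $ i\<bar> powr t) powr (1 / t) \<le> (real CARD('n) * norm x powr t) powr (1 / t)"
    using t by (intro powr_mono2) (auto intro: sum_nonneg)
  also have "\<dots> = real CARD('n) powr (1 / t) * norm x"
    using t by (simp add: powr_mult powr_powr)
  also have "\<dots> \<le> real CARD('n) * norm x"
    using t powr_mono[of "1 / t" 1 "real CARD('n)"] by (intro mult_right_mono) (simp_all add: Suc_leI)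
  finally show ?thesis using real t by (simp add: lp_norm_def)
qed

lemma norm_le_lp_norm:
  fixes x :: "real^'n"
  assumes "1 \<le> q"
  shows "norm x \<le> real CARD('n) * lp_norm q x"
proof -
  have "\<bar>x $ i\<bar> \<le> lp_norm q x" for i
  proof (cases q)
    case top
    then show ?thesis using component_le_infnorm_cart[of x i] by (simp add: lp_norm_def)
  next
    case (real t)
    then have t: "1 \<le> t" using assms by simp
    have "\<bar>x $ i\<bar> powr t \<le> (\<Sum>i\<in>UNIV. \<bar>x $ i\<bar> powr t)"
      by (rule member_le_sum) auto
    then have "(\<bar>x $ i\<bar> powr t) powr (1 / t) \<le> (\<Sum>i\<in>UNIV. \<bar>x $ i\<bar> powr t) powr (1 / t)"
      using t by (intro powr_mono2) auto
    then show ?thesis using real t by (simp add: lp_norm_def powr_powr)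
  qed
  then have "(\<Sum>i\<in>UNIV. \<bar>x $ i\<bar>) \<le> (\<Sum>i\<in>(UNIV::'n set). lp_norm q x)" by (intro sum_mono)
  then show ?thesis using norm_le_l1_cart[of x] by simp
qed

text \<open>The constraint as a family of inequalities linear in \<open>v\<close>, which is the form
  that passes to limits and midpoints.\<close>

definition dominated_variation ::
    "ennreal \<Rightarrow> (real^'n) set \<Rightarrow> (real^'n) measure \<Rightarrow> (real^'n \<Rightarrow> real) \<Rightarrow> bool" where
  "dominated_variation p \<Omega> \<alpha> v \<longleftrightarrow>
     (\<forall>U W. open U \<longrightarrow> U \<subseteq> \<Omega> \<longrightarrow> W \<in> C1_compact_support U \<longrightarrow>
        (\<forall>x. lp_norm (conjugate_exponent p) (W x) \<le> 1) \<longrightarrow>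
        (LINT x:U|lebesgue. v x * divergence W x) \<le> measure \<alpha> U)"

text \<open>On open sets both sides unfold to the same inequalities; general Borel sets are reached
  from open ones by outer regularity of \<alpha>.\<close>

lemma dominated_variation_iff:
  fixes \<Omega> :: "(real^'n) set"
  assumes \<Omega>: "open \<Omega>" and \<alpha>: "nonneg_borel_measure \<Omega> \<alpha>"
  shows "(\<forall>S\<in>sets borel. S \<subseteq> \<Omega> \<longrightarrow> variation p \<Omega> v S \<le> emeasure \<alpha> S) \<longleftrightarrow> dominated_variation p \<Omega> \<alpha> v"
    (is "?L \<longleftrightarrow> ?R")
proof
  interpret \<alpha>: finite_measure \<alpha> using \<alpha> by (simp add: nonneg_borel_measure_def)
  have sets\<alpha>: "sets \<alpha> = sets (restrict_space borel \<Omega>)" using \<alpha> by (simp add: nonneg_borel_measure_def)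
  have space: "space \<alpha> = \<Omega>" using sets_eq_imp_space_eq[OF sets\<alpha>] by (simp add: space_restrict_space)
  {
    assume ?L
    show ?R
      unfolding dominated_variation_def
    proof (intro allI impI)
      fix U W assume U: "open U" "U \<subseteq> \<Omega>" and W: "W \<in> C1_compact_support U"
        "\<forall>x. lp_norm (conjugate_exponent p) (W x) \<le> 1"
      have "ennreal (LINT x:U|lebesgue. v x * divergence W x) \<le> variation_open p v U"
        unfolding variation_open_def using W by (intro SUP_upper) simp
      also have "\<dots> = variation p \<Omega> v U" using variation_eq_variation_open[OF U] by simp
      also have "\<dots> \<le> emeasure \<alpha> U" using \<open>?L\<close> U by simp
      also have "\<dots> = ennreal (measure \<alpha> U)" by (rule \<alpha>.emeasure_eq_measure)
      finally show "(LINT x:U|lebesgue. v x * divergence W x) \<le> measure \<alpha> U"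
        by (simp add: ennreal_le_iff)
    qed
  }
  assume ?R
  have o: "variation_open p v U \<le> emeasure \<alpha> U" if "open U" "U \<subseteq> \<Omega>" for U
    unfolding variation_open_def
  proof (rule SUP_least)
    fix W assume "W \<in> {w \<in> C1_compact_support U. \<forall>x. lp_norm (conjugate_exponent p) (w x) \<le> 1}"
    then have "(LINT x:U|lebesgue. v x * divergence W x) \<le> measure \<alpha> U"
      using \<open>?R\<close> that unfolding dominated_variation_def by blast
    then show "ennreal (LINT x:U|lebesgue. v x * divergence W x) \<le> emeasure \<alpha> U"
      unfolding \<alpha>.emeasure_eq_measure by (rule ennreal_leI)
  qed
  \<comment> \<open>Outer regularity is applied to a Borel measure on the whole space, so \<alpha>
    is pushed forward along the inclusion of \<Omega>.\<close>
  define M where "M = distr \<alpha> borel (\<lambda>x. x)"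
  have meas: "(\<lambda>x. x) \<in> \<alpha> \<rightarrow>\<^sub>M borel"
    by (subst measurable_cong_sets[OF sets\<alpha> refl]) (simp add: measurable_restrict_space1)
  have M: "emeasure M S = emeasure \<alpha> (S \<inter> \<Omega>)" if "S \<in> sets borel" for S
    unfolding M_def using emeasure_distr[OF meas that] by (simp add: space)
  show ?L
  proof (intro ballI impI)
    fix S assume S: "S \<in> sets borel" "S \<subseteq> \<Omega>"
    have "variation p \<Omega> v S \<le> (INF U\<in>{U. S \<subseteq> U \<and> open U}. emeasure M U)"
    proof (rule INF_greatest)
      fix U assume "U \<in> {U. S \<subseteq> U \<and> open U}"
      then have U: "S \<subseteq> U" "open U" by auto
      then have "variation p \<Omega> v S \<le> variation_open p v (U \<inter> \<Omega>)"
        unfolding variation_def using \<Omega> S by (intro INF_lower) auto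
      also have "\<dots> \<le> emeasure \<alpha> (U \<inter> \<Omega>)" using U \<Omega> by (intro o) auto
      also have "\<dots> = emeasure M U" using U by (subst M) auto
      finally show "variation p \<Omega> v S \<le> emeasure M U" .
    qed
    also have "\<dots> = emeasure M S"
    proof (rule outer_regular[symmetric])
      show "sets M = sets borel" by (simp add: M_def)
      have "emeasure M (space M) = emeasure \<alpha> (UNIV \<inter> \<Omega>)" using M[of UNIV] by (simp add: M_def)
      then show "emeasure M (space M) \<noteq> \<infinity>" by simp
    qed (rule S(1))
    also have "\<dots> = emeasure \<alpha> S" using M[OF S(1)] S(2) by (simp add: Int_absorb2)
    finally show "variation p \<Omega> v S \<le> emeasure \<alpha> S" .
  qed
qed

text \<open>Normalizing \<open>W\<close> passes from fields admissible for the dual norm to fields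
  with a Euclidean bound. It serves the trace argument with bound 1 and finiteness of the Euclidean
  variation with bound CARD('n).\<close>

lemma dominated_variation_scaled:
  fixes v :: "real^'n \<Rightarrow> real"
  assumes v: "dominated_variation p \<Omega> \<alpha> v" and U: "open U" "U \<subseteq> \<Omega>"
    and W: "W \<in> C1_compact_support U" "\<And>x. norm (W x) \<le> b" and b: "0 < b"
  shows "(LINT x:U|lebesgue. v x * divergence W x) \<le> real CARD('n) * b * measure \<alpha> U"
proof -
  define c where "c = 1 / (real CARD('n) * b)"
  have c: "0 < c" using b by (simp add: c_def)
  have "lp_norm (conjugate_exponent p) (c *\<^sub>R W x) \<le> 1" for x
  proof -
    have "lp_norm (conjugate_exponent p) (c *\<^sub>R W x) \<le> real CARD('n) * norm (c *\<^sub>R W x)"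
      by (rule lp_norm_le_norm[OF conjugate_exponent_ge_1])
    also have "\<dots> = real CARD('n) * (c * norm (W x))" using c by simp
    also have "\<dots> \<le> real CARD('n) * (c * b)"
      using W(2) c by (intro mult_left_mono) auto
    also have "\<dots> = 1" using b by (simp add: c_def)
    finally show ?thesis .
  qed
  then have "(LINT x:U|lebesgue. v x * divergence (\<lambda>x. c *\<^sub>R W x) x) \<le> measure \<alpha> U"
    using v U C1_compact_support_scaleR(1)[OF W(1)] unfolding dominated_variation_def by blast
  then have "(LINT x:U|lebesgue. c * (v x * divergence W x)) \<le> measure \<alpha> U"
    unfolding C1_compact_support_scaleR(2)[OF W(1)] by (simp only: mult.left_commute)
  then have "c * (LINT x:U|lebesgue. v x * divergence W x) \<le> measure \<alpha> U" by simp
  then show ?thesis using b by (simp add: c_def field_simps)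
qed

text \<open>Finiteness of the variation required by \<open>BV\<close> is derived from domination: on
  \<Omega> the variation for exponent 2 is at most a constant times the finite mass of
  \<alpha>.\<close>

lemma mem_constraint_set_iff:
  fixes \<Omega> :: "(real^'n) set"
  assumes \<Omega>: "open \<Omega>" and \<alpha>: "nonneg_borel_measure \<Omega> \<alpha>"
  shows "v \<in> constraint_set p \<Omega> \<Gamma>D \<alpha> \<longleftrightarrow>
    integrable (lebesgue_on \<Omega>) v \<and> dominated_variation p \<Omega> \<alpha> v \<and>
    (\<exists>N. hausdorff_measure (CARD('n) - 1) N = 0 \<and> (\<forall>x\<in>\<Gamma>D - N. has_trace_at \<Omega> v x 0))"
proof -
  have "variation 2 \<Omega> v \<Omega> < \<infinity>" if v: "dominated_variation p \<Omega> \<alpha> v"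
  proof -
    have "variation_open 2 v \<Omega> \<le> ennreal (real CARD('n) * real CARD('n) * measure \<alpha> \<Omega>)"
      unfolding variation_open_def
    proof (intro SUP_least ennreal_leI)
      fix W assume "W \<in> {w \<in> C1_compact_support \<Omega>. \<forall>x. lp_norm (conjugate_exponent 2) (w x) \<le> 1}"
      then have W: "W \<in> C1_compact_support \<Omega>" "\<And>x. lp_norm (conjugate_exponent 2) (W x) \<le> 1" by auto
      have "norm (W x) \<le> real CARD('n) * 1" for x
        by (rule order_trans[OF norm_le_lp_norm[OF conjugate_exponent_ge_1, of "W x" 2]])
           (intro mult_left_mono W(2), simp)
      from dominated_variation_scaled[OF v \<Omega> subset_refl W(1) this]
      show "(LINT x:\<Omega>|lebesgue. v x * divergence W x) \<le> real CARD('n) * real CARD('n) * measure \<alpha> \<Omega>"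
        by simp
    qed
    then show ?thesis
      using variation_eq_variation_open[OF \<Omega> subset_refl, of 2 v] by (simp add: order.strict_trans1)
  qed
  then show ?thesis
    unfolding constraint_set_def BV_zero_trace_def BV_def mem_Collect_eq
      dominated_variation_iff[OF \<Omega> \<alpha>] by blast
qed

section \<open>Test inequalities under L^1 limits and midpoints\<close>

lemma divergence_bounded:
  assumes "W \<in> C1_compact_support U"
  shows "divergence W \<in> borel_measurable lebesgue" "\<exists>b. \<forall>x. \<bar>divergence W x\<bar> \<le> b"
proof -
  let ?S = "closure {x. W x \<noteq> 0}"
  have c: "continuous_on UNIV (divergence W)"
    unfolding divergence_def[abs_def] using assms
    by (intro continuous_intros) (auto simp: C1_compact_support_def)
  then show "divergence W \<in> borel_measurable lebesgue"
    by (intro measurable_completion) (simp add: borel_measurable_continuous_onI)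
  have "compact ?S" using assms by (simp add: C1_compact_support_def)
  then have "bounded (divergence W ` ?S)"
    by (intro compact_imp_bounded compact_continuous_image continuous_on_subset[OF c]) auto
  then obtain b where b: "0 < b" "\<And>x. x \<in> ?S \<Longrightarrow> \<bar>divergence W x\<bar> \<le> b"
    unfolding bounded_pos by auto
  have "\<bar>divergence W x\<bar> \<le> b" for x
    using b divergence_eq_0[of x W] by (cases "x \<in> ?S") auto
  then show "\<exists>b. \<forall>x. \<bar>divergence W x\<bar> \<le> b" by blast
qed

lemma integrable_mult_divergence:
  fixes v :: "real^'n \<Rightarrow> real"
  assumes \<Omega>: "open \<Omega>" and v: "integrable (lebesgue_on \<Omega>) v"
    and U: "open U" "U \<subseteq> \<Omega>" and W: "W \<in> C1_compact_support U"
  shows "set_integrable lebesgue U (\<lambda>x. v x * divergence W x)"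
proof -
  obtain b where b: "\<And>x. \<bar>divergence W x\<bar> \<le> b" using divergence_bounded(2)[OF W] by blast
  have [measurable]: "U \<in> sets lebesgue" using U by auto
  have "set_integrable lebesgue \<Omega> v"
    unfolding set_integrable_def using v \<Omega> by (simp add: integrable_restrict_space)
  then have "set_integrable lebesgue U v" by (rule set_integrable_subset) (use U in auto)
  then have i: "integrable lebesgue (\<lambda>x. indicator U x *\<^sub>R v x)" by (simp add: set_integrable_def)
  have "integrable lebesgue (\<lambda>x. (indicator U x *\<^sub>R v x) * divergence W x)"
  proof (rule Bochner_Integration.integrable_bound)
    show "integrable lebesgue (\<lambda>x. b * (indicator U x *\<^sub>R v x))" using i by simp
    show "(\<lambda>x. (indicator U x *\<^sub>R v x) * divergence W x) \<in> borel_measurable lebesgue"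
      using i divergence_bounded(1)[OF W] by (intro borel_measurable_times) auto
    have "\<bar>a * divergence W x\<bar> \<le> \<bar>b * a\<bar>" for a x
      using mult_left_mono[OF order_trans[OF b[of x] abs_ge_self], of "\<bar>a\<bar>"] by (simp add: abs_mult mult.commute)
    then show "AE x in lebesgue. norm ((indicator U x *\<^sub>R v x) * divergence W x) \<le> norm (b * (indicator U x *\<^sub>R v x))"
      by simp
  qed
  then show ?thesis by (simp add: set_integrable_def mult.assoc)
qed

text \<open>For a fixed field the divergence is bounded, so the tested integral is continuous in L^1
  and the non-strict inequality survives the limit.\<close>

lemma dominated_variation_limit:
  fixes u :: "real^'n \<Rightarrow> real"
  assumes \<Omega>: "open \<Omega>" and u: "integrable (lebesgue_on \<Omega>) u"
    and s: "\<And>n. integrable (lebesgue_on \<Omega>) (s n)" "\<And>n. dominated_variation p \<Omega> \<alpha> (s n)"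
    and lim: "(\<lambda>n. LINT x|lebesgue_on \<Omega>. \<bar>u x - s n x\<bar>) \<longlonglongrightarrow> 0"
  shows "dominated_variation p \<Omega> \<alpha> u"
  unfolding dominated_variation_def
proof (intro allI impI)
  fix U W assume U: "open U" "U \<subseteq> \<Omega>" and W: "W \<in> C1_compact_support U"
    and W1: "\<forall>x. lp_norm (conjugate_exponent p) (W x) \<le> 1"
  obtain b where b: "\<And>x. \<bar>divergence W x\<bar> \<le> b" using divergence_bounded(2)[OF W] by blast
  have bound: "(LINT x:U|lebesgue. u x * divergence W x)
      \<le> b * (LINT x|lebesgue_on \<Omega>. \<bar>u x - s n x\<bar>) + measure \<alpha> U" for n
  proof -
    have d: "integrable (lebesgue_on \<Omega>) (\<lambda>x. u x - s n x)" using u s by simp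
    have id: "set_integrable lebesgue U (\<lambda>x. (u x - s n x) * divergence W x)"
      by (rule integrable_mult_divergence[OF \<Omega> d U W])
    have is': "set_integrable lebesgue U (\<lambda>x. s n x * divergence W x)"
      by (rule integrable_mult_divergence[OF \<Omega> s(1) U W])
    have "(LINT x:U|lebesgue. u x * divergence W x)
        = (LINT x:U|lebesgue. (u x - s n x) * divergence W x) + (LINT x:U|lebesgue. s n x * divergence W x)"
      using set_integral_add(2)[OF id is'] by (simp add: algebra_simps)
    also have "(LINT x:U|lebesgue. s n x * divergence W x) \<le> measure \<alpha> U"
      using s(2)[of n] U W W1 unfolding dominated_variation_def by blast
    also have "(LINT x:U|lebesgue. (u x - s n x) * divergence W x)
        \<le> (LINT x|lebesgue. b * (indicator \<Omega> x *\<^sub>R \<bar>u x - s n x\<bar>))"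
      unfolding set_lebesgue_integral_def
    proof (rule integral_mono)
      show "integrable lebesgue (\<lambda>x. indicat_real U x *\<^sub>R ((u x - s n x) * divergence W x))"
        using id by (simp add: set_integrable_def)
      have "integrable (lebesgue_on \<Omega>) (\<lambda>x. \<bar>u x - s n x\<bar>)" using d by simp
      then show "integrable lebesgue (\<lambda>x. b * (indicat_real \<Omega> x *\<^sub>R \<bar>u x - s n x\<bar>))"
        using \<Omega> by (subst (asm) integrable_restrict_space) auto
      fix x
      have "\<bar>(u x - s n x) * divergence W x\<bar> \<le> \<bar>u x - s n x\<bar> * b"
        unfolding abs_mult by (intro mult_left_mono b) simp
      then have "(u x - s n x) * divergence W x \<le> b * \<bar>u x - s n x\<bar>"
        by (metis abs_ge_self mult.commute order_trans)
      moreover have "0 \<le> b * \<bar>u x - s n x\<bar>"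
        using order_trans[OF abs_ge_zero b] by simp
      ultimately show "indicat_real U x *\<^sub>R ((u x - s n x) * divergence W x) \<le> b * (indicat_real \<Omega> x *\<^sub>R \<bar>u x - s n x\<bar>)"
        using U(2) by (cases "x \<in> U"; cases "x \<in> \<Omega>") auto
    qed
    also have "\<dots> = b * (LINT x|lebesgue_on \<Omega>. \<bar>u x - s n x\<bar>)"
      using \<Omega> by (subst integral_restrict_space) auto
    finally show ?thesis by simp
  qed
  have "(\<lambda>n. b * (LINT x|lebesgue_on \<Omega>. \<bar>u x - s n x\<bar>) + measure \<alpha> U) \<longlonglongrightarrow> b * 0 + measure \<alpha> U"
    by (intro tendsto_intros lim)
  from LIMSEQ_le_const[OF this] bound
  show "(LINT x:U|lebesgue. u x * divergence W x) \<le> measure \<alpha> U" by auto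
qed

text \<open>Each tested inequality is linear in the function. Midpoints are the convex combinations
  that enter the parallelogram identity.\<close>

lemma dominated_variation_midpoint:
  fixes u v :: "real^'n \<Rightarrow> real"
  assumes \<Omega>: "open \<Omega>" and u: "integrable (lebesgue_on \<Omega>) u" "dominated_variation p \<Omega> \<alpha> u"
    and v: "integrable (lebesgue_on \<Omega>) v" "dominated_variation p \<Omega> \<alpha> v"
  shows "dominated_variation p \<Omega> \<alpha> (\<lambda>x. (u x + v x) / 2)"
  unfolding dominated_variation_def
proof (intro allI impI)
  fix U W assume U: "open U" "U \<subseteq> \<Omega>" and W: "W \<in> C1_compact_support U"
    and W1: "\<forall>x. lp_norm (conjugate_exponent p) (W x) \<le> 1"
  have "(LINT x:U|lebesgue. (u x + v x) / 2 * divergence W x)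
      = (LINT x:U|lebesgue. u x * divergence W x + v x * divergence W x) / 2"
    by (simp add: algebra_simps flip: set_integral_divide_zero)
  also have "\<dots> = ((LINT x:U|lebesgue. u x * divergence W x) + (LINT x:U|lebesgue. v x * divergence W x)) / 2"
    using set_integral_add(2)[OF integrable_mult_divergence[OF \<Omega> u(1) U W] integrable_mult_divergence[OF \<Omega> v(1) U W]]
    by simp
  also have "\<dots> \<le> measure \<alpha> U"
  proof -
    have "(LINT x:U|lebesgue. u x * divergence W x) \<le> measure \<alpha> U"
      "(LINT x:U|lebesgue. v x * divergence W x) \<le> measure \<alpha> U"
      using u(2) v(2) U W W1 unfolding dominated_variation_def by blast+
    then show ?thesis by simp
  qed
  finally show "(LINT x:U|lebesgue. (u x + v x) / 2 * divergence W x) \<le> measure \<alpha> U" .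
qed

subsection \<open>Nearest points in \<open>L\<^sup>2\<close>\<close>

text \<open>Fatou's lemma, with integrability of the limit as part of the conclusion.\<close>

lemma integral_le_of_AE_limit:
  fixes h :: "nat \<Rightarrow> 'a \<Rightarrow> real"
  assumes h: "\<And>n. integrable M (h n)" "\<And>n x. 0 \<le> h n x"
    and k[measurable]: "k \<in> borel_measurable M"
    and lim: "AE x in M. (\<lambda>n. h n x) \<longlonglongrightarrow> k x"
    and B: "\<And>n. N \<le> n \<Longrightarrow> (\<integral>x. h n x \<partial>M) \<le> B"
  shows "integrable M k" "(\<integral>x. k x \<partial>M) \<le> B"
proof -
  have [measurable]: "h n \<in> borel_measurable M" for n using h(1) by simp
  have nonneg: "AE x in M. 0 \<le> k x"
    using lim by eventually_elim (rule LIMSEQ_le_const, use h(2) in auto)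
  have "0 \<le> (\<integral>x. h N x \<partial>M)" using h(2) by (intro Bochner_Integration.integral_nonneg) simp
  then have B0: "0 \<le> B" using B[of N] by simp
  have "(\<integral>\<^sup>+x. ennreal (k x) \<partial>M) = (\<integral>\<^sup>+x. liminf (\<lambda>n. ennreal (h n x)) \<partial>M)"
  proof (rule nn_integral_cong_AE)
    show "AE x in M. ennreal (k x) = liminf (\<lambda>n. ennreal (h n x))"
      using lim
    proof eventually_elim
      case (elim x)
      then have "(\<lambda>n. ennreal (h n x)) \<longlonglongrightarrow> ennreal (k x)" by (rule tendsto_ennrealI)
      then show ?case by (simp add: lim_imp_Liminf)
    qed
  qed
  also have "\<dots> \<le> liminf (\<lambda>n. \<integral>\<^sup>+x. ennreal (h n x) \<partial>M)"
    by (intro nn_integral_liminf) simp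
  also have "\<dots> \<le> limsup (\<lambda>n. \<integral>\<^sup>+x. ennreal (h n x) \<partial>M)"
    by (intro Liminf_le_Limsup) simp
  also have "\<dots> \<le> ennreal B"
  proof (rule Limsup_bounded)
    show "\<forall>\<^sub>F n in sequentially. (\<integral>\<^sup>+x. ennreal (h n x) \<partial>M) \<le> ennreal B"
      unfolding eventually_sequentially
      using B h by (intro exI[of _ N]) (simp add: nn_integral_eq_integral ennreal_leI)
  qed
  finally have fin: "(\<integral>\<^sup>+x. ennreal (k x) \<partial>M) \<le> ennreal B" .
  then have "(\<integral>\<^sup>+x. ennreal (k x) \<partial>M) < \<infinity>" by (rule order.strict_trans1) simp
  then show int: "integrable M k" using nonneg by (intro integrableI_nonneg) auto
  show "(\<integral>x. k x \<partial>M) \<le> B"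
    using fin B0 nn_integral_eq_integral[OF int nonneg] by simp
qed

lemma integrable_square_diff:
  fixes u v :: "'a \<Rightarrow> real"
  assumes [measurable]: "u \<in> borel_measurable M" "v \<in> borel_measurable M"
    and "integrable M (\<lambda>x. (u x)\<^sup>2)" "integrable M (\<lambda>x. (v x)\<^sup>2)"
  shows "integrable M (\<lambda>x. (u x - v x)\<^sup>2)"
proof (rule Bochner_Integration.integrable_bound)
  show "integrable M (\<lambda>x. 2 * (u x)\<^sup>2 + 2 * (v x)\<^sup>2)" using assms by simp
  have "(a - b)\<^sup>2 \<le> 2 * a\<^sup>2 + 2 * b\<^sup>2" for a b :: real
    using zero_le_power2[of "a + b"] by (simp add: power2_eq_square algebra_simps)
  then show "AE x in M. norm ((u x - v x)\<^sup>2) \<le> norm (2 * (u x)\<^sup>2 + 2 * (v x)\<^sup>2)"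
    by simp
qed simp

context finite_measure
begin

lemma integrable_of_square:
  fixes u :: "'a \<Rightarrow> real"
  assumes [measurable]: "u \<in> borel_measurable M" and "integrable M (\<lambda>x. (u x)\<^sup>2)"
  shows "integrable M u"
proof (rule Bochner_Integration.integrable_bound)
  show "integrable M (\<lambda>x. 1 + (u x)\<^sup>2)" using assms by simp
  have "\<bar>a\<bar> \<le> 1 + a\<^sup>2" for a :: real
    using zero_le_power2[of "\<bar>a\<bar> - 1"] by (simp add: power2_eq_square algebra_simps)
  then show "AE x in M. norm (u x) \<le> norm (1 + (u x)\<^sup>2)" by simp
qed simp

text \<open>On a finite measure space small L^2 norm forces small L^1 norm, here through |h| \<le>
  a/2 + h^2/(2a). The parameter \<open>a\<close> makes the constant term integrate to less than
  \<epsilon>/2, and \<eta> = a \<epsilon> does the same for the quadratic one.\<close>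

lemma integral_abs_small:
  assumes "0 < \<epsilon>"
  obtains \<eta> :: real where "0 < \<eta>"
    "\<And>h :: 'a \<Rightarrow> real. h \<in> borel_measurable M \<Longrightarrow> integrable M (\<lambda>x. (h x)\<^sup>2) \<Longrightarrow> (\<integral>x. (h x)\<^sup>2 \<partial>M) < \<eta> \<Longrightarrow>
       (\<integral>x. \<bar>h x\<bar> \<partial>M) < \<epsilon>"
proof -
  define a where "a = \<epsilon> / (measure M (space M) + 1)"
  have pos: "0 < measure M (space M) + 1" by (simp add: add_nonneg_pos)
  then have a: "0 < a" "a * measure M (space M) < \<epsilon>"
    using assms by (auto simp: a_def field_simps)
  show ?thesis
  proof (rule that[of "a * \<epsilon>"])
    fix h :: "'a \<Rightarrow> real"
    assume [measurable]: "h \<in> borel_measurable M" and h2: "integrable M (\<lambda>x. (h x)\<^sup>2)"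
      and small: "(\<integral>x. (h x)\<^sup>2 \<partial>M) < a * \<epsilon>"
    have "(\<integral>x. \<bar>h x\<bar> \<partial>M) \<le> (\<integral>x. a / 2 + (h x)\<^sup>2 / (2 * a) \<partial>M)"
    proof (intro integral_mono)
      show "integrable M (\<lambda>x. \<bar>h x\<bar>)" using integrable_of_square[of h] h2 by simp
      fix x
      have "0 \<le> (a - \<bar>h x\<bar>)\<^sup>2" by simp
      then show "\<bar>h x\<bar> \<le> a / 2 + (h x)\<^sup>2 / (2 * a)"
        using a(1) by (simp add: field_simps power2_eq_square)
    qed (use h2 in simp)
    also have "\<dots> = a * measure M (space M) / 2 + (\<integral>x. (h x)\<^sup>2 \<partial>M) / (2 * a)"
      using h2 by simp
    also have "\<dots> < \<epsilon> / 2 + \<epsilon> / 2"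
      using a small by (intro add_strict_mono) (simp_all add: field_simps)
    finally show "(\<integral>x. \<bar>h x\<bar> \<partial>M) < \<epsilon>" by simp
  qed (use a assms in simp)
qed

text \<open>The parallelogram law for \<open>u - f\<close> and \<open>v - f\<close>. The midpoint
  enters with a minus sign, so a lower bound on its distance to \<open>f\<close> controls the
  distance of \<open>u\<close> and \<open>v\<close>.\<close>

lemma parallelogram:
  fixes u v f :: "'a \<Rightarrow> real"
  assumes [measurable]: "u \<in> borel_measurable M" "v \<in> borel_measurable M" "f \<in> borel_measurable M"
    and u2: "integrable M (\<lambda>x. (u x)\<^sup>2)" and v2: "integrable M (\<lambda>x. (v x)\<^sup>2)"
    and f2: "integrable M (\<lambda>x. (f x)\<^sup>2)"
  shows "(\<integral>x. (u x - v x)\<^sup>2 \<partial>M) =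
    2 * (\<integral>x. (u x - f x)\<^sup>2 \<partial>M) + 2 * (\<integral>x. (v x - f x)\<^sup>2 \<partial>M) - 4 * (\<integral>x. ((u x + v x) / 2 - f x)\<^sup>2 \<partial>M)"
proof -
  note i = integrable_square_diff[OF _ _ u2 f2] integrable_square_diff[OF _ _ v2 f2] integrable_square_diff[OF _ _ u2 v2]
  have "(\<integral>x. ((u x + v x) / 2 - f x)\<^sup>2 \<partial>M)
      = (\<integral>x. (u x - f x)\<^sup>2 / 2 + (v x - f x)\<^sup>2 / 2 - (u x - v x)\<^sup>2 / 4 \<partial>M)"
    by (intro Bochner_Integration.integral_cong) (auto simp: power2_eq_square field_simps)
  then show ?thesis using i by simp
qed

text \<open>A minimizing sequence is Cauchy by the parallelogram law; an almost everywhere limit of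
  a subsequence is the minimizer by Fatou. Closedness is asked with respect to L^1 convergence, the
  mode in which traces and variation bounds are preserved.\<close>

proposition nearest_point_exists:
  fixes f :: "'a \<Rightarrow> real" and K :: "('a \<Rightarrow> real) set"
  assumes f[measurable]: "f \<in> borel_measurable M" and f2: "integrable M (\<lambda>x. (f x)\<^sup>2)"
    and K: "\<And>u. u \<in> K \<Longrightarrow> u \<in> borel_measurable M" "\<And>u. u \<in> K \<Longrightarrow> integrable M (\<lambda>x. (u x)\<^sup>2)"
    and "K \<noteq> {}"
    and mid: "\<And>u v. u \<in> K \<Longrightarrow> v \<in> K \<Longrightarrow> (\<lambda>x. (u x + v x) / 2) \<in> K"
    and closed: "\<And>s u. (\<And>n. s n \<in> K) \<Longrightarrow> u \<in> borel_measurable M \<Longrightarrow> integrable M (\<lambda>x. (u x)\<^sup>2) \<Longrightarrow>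
        (\<lambda>n. \<integral>x. \<bar>u x - s n x\<bar> \<partial>M) \<longlonglongrightarrow> 0 \<Longrightarrow> u \<in> K"
  obtains u where "u \<in> K" "\<And>v. v \<in> K \<Longrightarrow> (\<integral>x. (u x - f x)\<^sup>2 \<partial>M) \<le> (\<integral>x. (v x - f x)\<^sup>2 \<partial>M)"
proof -
  define D where "D u = (\<integral>x. (u x - f x)\<^sup>2 \<partial>M)" for u
  define m where "m = (INF u\<in>K. D u)"
  have bdd: "bdd_below (D ` K)" by (rule bdd_belowI[of _ 0]) (auto simp: D_def)
  have m: "m \<le> D u" if "u \<in> K" for u unfolding m_def using bdd that by (rule cINF_lower)
  have "\<exists>u\<in>K. D u < m + 1 / real (Suc n)" for n
    using cINF_less_iff[OF \<open>K \<noteq> {}\<close> bdd, of "m + 1 / real (Suc n)"] by (simp add: m_def)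
  then obtain s where s: "\<And>n. s n \<in> K" "\<And>n. D (s n) < m + 1 / real (Suc n)" by metis
  have [measurable]: "s n \<in> borel_measurable M" for n using K(1) s(1) by blast
  have s2: "integrable M (\<lambda>x. (s n x)\<^sup>2)" for n using K(2) s(1) by blast
  \<comment> \<open>The midpoint lies in \<open>K\<close>, so its term is at most - 4m and cancels
    the 4m coming from \<open>s i\<close> and \<open>s j\<close>.\<close>
  have "(\<integral>x. (s i x - s j x)\<^sup>2 \<partial>M) \<le> 2 / real (Suc i) + 2 / real (Suc j)" for i j
    using parallelogram[OF _ _ _ s2[of i] s2[of j] f2] m[OF mid[OF s(1)[of i] s(1)[of j]]] s(2)[of i] s(2)[of j]
    by (simp add: D_def)
  then have cauchy: "\<exists>N. \<forall>i\<ge>N. \<forall>j\<ge>N. (\<integral>x. \<bar>s i x - s j x\<bar> \<partial>M) < \<epsilon>" if "0 < \<epsilon>" for \<epsilon>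
  proof -
    obtain \<eta> where \<eta>: "0 < \<eta>"
      "\<And>h :: 'a \<Rightarrow> real. h \<in> borel_measurable M \<Longrightarrow> integrable M (\<lambda>x. (h x)\<^sup>2) \<Longrightarrow> (\<integral>x. (h x)\<^sup>2 \<partial>M) < \<eta> \<Longrightarrow>
         (\<integral>x. \<bar>h x\<bar> \<partial>M) < \<epsilon>"
      using integral_abs_small[OF \<open>0 < \<epsilon>\<close>] by blast
    obtain N where N: "1 / real (Suc N) < \<eta> / 4" using nat_approx_posE[of "\<eta> / 4"] \<eta>(1) by auto
    have small: "1 / real (Suc i) < \<eta> / 4" if "N \<le> i" for i
      using N that by (meson frac_le le_less_trans of_nat_0_less_iff of_nat_mono Suc_le_mono zero_less_Suc order_refl zero_le_one)
    show ?thesis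
    proof (intro exI[of _ N] allI impI)
      fix i j assume "N \<le> i" "N \<le> j"
      then have "2 / real (Suc i) + 2 / real (Suc j) < \<eta>" using small[of i] small[of j] by simp
      with \<open>\<And>i j. (\<integral>x. (s i x - s j x)\<^sup>2 \<partial>M) \<le> 2 / real (Suc i) + 2 / real (Suc j)\<close>[of i j]
      show "(\<integral>x. \<bar>s i x - s j x\<bar> \<partial>M) < \<epsilon>"
        by (intro \<eta>(2) integrable_square_diff s2) auto
    qed
  qed
  have s1: "integrable M (s n)" for n by (rule integrable_of_square[OF _ s2]) simp
  have "\<exists>N. \<forall>i\<ge>N. \<forall>j\<ge>N. (\<integral>x. norm (s i x - s j x) \<partial>M) < \<epsilon>" if "0 < \<epsilon>" for \<epsilon>
    using cauchy[OF that] by simp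
  from cauchy_L1_AE_cauchy_subseq[OF s1 this]
  obtain r where r: "strict_mono r" "AE x in M. Cauchy (\<lambda>i. s (r i) x)" by blast
  \<comment> \<open>Where the subsequence diverges, \<open>u\<close> has an unspecified value, but
    it is measurable as a pointwise \<open>lim\<close>.\<close>
  define u where "u x = lim (\<lambda>i. s (r i) x)" for x
  have [measurable]: "u \<in> borel_measurable M"
    unfolding u_def[abs_def] by (rule borel_measurable_lim_metric) simp
  have lim: "AE x in M. (\<lambda>i. s (r i) x) \<longlonglongrightarrow> u x"
    using r(2) by eventually_elim (simp add: u_def real_Cauchy_convergent convergent_LIMSEQ_iff[symmetric])
  \<comment> \<open>Fatou along the subsequence, using only its tail where the distances are below m
    + \<epsilon>.\<close>
  have Du: "integrable M (\<lambda>x. (u x - f x)\<^sup>2)" "D u \<le> m + \<epsilon>" if \<epsilon>: "0 < \<epsilon>" for \<epsilon>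
  proof -
    obtain N where N: "1 / real (Suc N) < \<epsilon>" using nat_approx_posE[OF \<epsilon>] by auto
    have bound: "(\<integral>x. (s (r n) x - f x)\<^sup>2 \<partial>M) \<le> m + \<epsilon>" if "N \<le> n" for n
    proof -
      have "N \<le> r n" using that seq_suble[OF r(1), of n] by simp
      then have "1 / real (Suc (r n)) \<le> 1 / real (Suc N)" by (simp add: frac_le)
      then show ?thesis using s(2)[of "r n"] N by (simp add: D_def)
    qed
    have l: "AE x in M. (\<lambda>n. (s (r n) x - f x)\<^sup>2) \<longlonglongrightarrow> (u x - f x)\<^sup>2"
      using lim by eventually_elim (intro tendsto_intros)
    have i: "integrable M (\<lambda>x. (s (r n) x - f x)\<^sup>2)" for n
      by (intro integrable_square_diff s2 f2) auto
    show "integrable M (\<lambda>x. (u x - f x)\<^sup>2)"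
      by (rule integral_le_of_AE_limit(1)[OF i _ _ l bound]) auto
    show "D u \<le> m + \<epsilon>" unfolding D_def
      by (rule integral_le_of_AE_limit(2)[OF i _ _ l bound]) auto
  qed
  have "integrable M (\<lambda>x. (u x - f x - (- f x))\<^sup>2)"
    by (rule integrable_square_diff) (use Du(1)[of 1] f2 in simp_all)
  then have u2: "integrable M (\<lambda>x. (u x)\<^sup>2)" by simp
  have "(\<lambda>n. \<integral>x. \<bar>u x - s n x\<bar> \<partial>M) \<longlonglongrightarrow> 0"
  proof (rule LIMSEQ_I)
    fix \<epsilon> :: real assume "0 < \<epsilon>"
    then have "0 < \<epsilon> / 2" by simp
    from cauchy[OF this] obtain N where N: "\<And>i j. N \<le> i \<Longrightarrow> N \<le> j \<Longrightarrow> (\<integral>x. \<bar>s i x - s j x\<bar> \<partial>M) < \<epsilon> / 2"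
      by blast
    \<comment> \<open>With \<open>k\<close> fixed, Fatou in the subsequence index turns the Cauchy
      bound into a bound on the distance to \<open>u\<close>. This gives convergence of the whole
      sequence.\<close>
    have "(\<integral>x. \<bar>u x - s k x\<bar> \<partial>M) \<le> \<epsilon> / 2" if "N \<le> k" for k
    proof (rule integral_le_of_AE_limit(2)[where h = "\<lambda>n x. \<bar>s (r n) x - s k x\<bar>" and N = N])
      show "(\<integral>x. \<bar>s (r n) x - s k x\<bar> \<partial>M) \<le> \<epsilon> / 2" if "N \<le> n" for n
        using N[of "r n" k] seq_suble[OF r(1), of n] that \<open>N \<le> k\<close> by simp
      show "AE x in M. (\<lambda>n. \<bar>s (r n) x - s k x\<bar>) \<longlonglongrightarrow> \<bar>u x - s k x\<bar>"
        using lim by eventually_elim (intro tendsto_intros)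
    qed (use s1 in auto)
    moreover have "0 \<le> (\<integral>x. \<bar>u x - s k x\<bar> \<partial>M)" for k
      by (intro Bochner_Integration.integral_nonneg) simp
    ultimately have "\<forall>k\<ge>N. norm ((\<integral>x. \<bar>u x - s k x\<bar> \<partial>M) - 0) < \<epsilon>"
      using \<open>0 < \<epsilon>\<close> by fastforce
    then show "\<exists>N. \<forall>n\<ge>N. norm ((\<integral>x. \<bar>u x - s n x\<bar> \<partial>M) - 0) < \<epsilon>" ..
  qed
  with s(1) u2 have "u \<in> K" by (intro closed[of s u]) auto
  moreover have "D u \<le> m" by (rule field_le_epsilon) (rule Du(2))
  then have "D u \<le> D v" if "v \<in> K" for v using m[OF that] by simp
  ultimately show ?thesis using that unfolding D_def by blast
qed

text \<open>Comparing both functions with their midpoint makes the right side of the parallelogram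
  law nonpositive.\<close>

lemma nearest_point_unique:
  fixes f u v :: "'a \<Rightarrow> real"
  assumes [measurable]: "u \<in> borel_measurable M" "v \<in> borel_measurable M" "f \<in> borel_measurable M"
    and u2: "integrable M (\<lambda>x. (u x)\<^sup>2)" and v2: "integrable M (\<lambda>x. (v x)\<^sup>2)"
    and f2: "integrable M (\<lambda>x. (f x)\<^sup>2)"
    and "(\<integral>x. (u x - f x)\<^sup>2 \<partial>M) \<le> (\<integral>x. ((u x + v x) / 2 - f x)\<^sup>2 \<partial>M)"
    and "(\<integral>x. (v x - f x)\<^sup>2 \<partial>M) \<le> (\<integral>x. ((u x + v x) / 2 - f x)\<^sup>2 \<partial>M)"
  shows "AE x in M. u x = v x"
proof -
  have "(\<integral>x. (u x - v x)\<^sup>2 \<partial>M) \<le> 0"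
    using parallelogram[OF _ _ _ u2 v2 f2] assms(7,8) by simp
  moreover have "0 \<le> (\<integral>x. (u x - v x)\<^sup>2 \<partial>M)" by (simp add: Bochner_Integration.integral_nonneg)
  ultimately have "(\<integral>x. (u x - v x)\<^sup>2 \<partial>M) = 0" by simp
  moreover have "integrable M (\<lambda>x. (u x - v x)\<^sup>2)" using u2 v2 by (intro integrable_square_diff) auto
  ultimately have "AE x in M. (u x - v x)\<^sup>2 = 0"
    by (subst (asm) integral_nonneg_eq_0_iff_AE) auto
  then show ?thesis by simp
qed

end

subsection \<open>The constraint set\<close>

text \<open>Membership in the constraint set concerns \<open>lebesgue_on \<Omega>\<close>, while the
  slide and trace estimates integrate over the whole space; this extension mediates between
  them.\<close>

definition zero_extension :: "'a set \<Rightarrow> ('a \<Rightarrow> real) \<Rightarrow> 'a \<Rightarrow> real" where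
  "zero_extension \<Omega> v x = indicat_real \<Omega> x *\<^sub>R v x"

lemma has_trace_at_zero_extension: "has_trace_at \<Omega> (zero_extension \<Omega> v) x t \<longleftrightarrow> has_trace_at \<Omega> v x t"
proof -
  have "indicat_real (\<Omega> \<inter> ball x r) y *\<^sub>R \<bar>zero_extension \<Omega> v y - t\<bar>
      = indicat_real (\<Omega> \<inter> ball x r) y *\<^sub>R \<bar>v y - t\<bar>" for r y
    by (cases "y \<in> \<Omega>") (simp_all add: zero_extension_def)
  then show ?thesis by (simp only: has_trace_at_def set_lebesgue_integral_def)
qed

lemma has_trace_at_midpoint:
  fixes u v :: "real^'n \<Rightarrow> real"
  assumes \<Omega>: "open \<Omega>" and u: "integrable (lebesgue_on \<Omega>) u" "has_trace_at \<Omega> u x 0"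
    and v: "integrable (lebesgue_on \<Omega>) v" "has_trace_at \<Omega> v x 0"
  shows "has_trace_at \<Omega> (\<lambda>y. (u y + v y) / 2) x 0"
proof -
  define I where "I w r = (LINT y:\<Omega> \<inter> ball x r|lebesgue. \<bar>w y\<bar>)" for w :: "real^'n \<Rightarrow> real" and r
  have i: "set_integrable lebesgue (\<Omega> \<inter> ball x r) (\<lambda>y. \<bar>w y\<bar>)" if "integrable (lebesgue_on \<Omega>) w"
    for w :: "real^'n \<Rightarrow> real" and r
  proof (rule set_integrable_subset)
    show "set_integrable lebesgue \<Omega> (\<lambda>y. \<bar>w y\<bar>)"
      unfolding set_integrable_def using integrable_abs[OF that] \<Omega> by (simp add: integrable_restrict_space)
  qed (use \<Omega> in auto)
  have uv: "integrable (lebesgue_on \<Omega>) (\<lambda>y. (u y + v y) / 2)" using u v by simp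
  have le: "I (\<lambda>y. (u y + v y) / 2) r \<le> I u r + I v r" for r
  proof -
    have "\<bar>(u y + v y) / 2\<bar> \<le> \<bar>u y\<bar> + \<bar>v y\<bar>" for y
      using abs_triangle_ineq[of "u y" "v y"] abs_ge_zero[of "u y"] abs_ge_zero[of "v y"] unfolding abs_divide by simp
    then have "I (\<lambda>y. (u y + v y) / 2) r \<le> (LINT y:\<Omega> \<inter> ball x r|lebesgue. \<bar>u y\<bar> + \<bar>v y\<bar>)"
      unfolding I_def by (intro set_integral_mono set_integral_add i uv u(1) v(1))
    also have "\<dots> = I u r + I v r"
      unfolding I_def by (intro set_integral_add i u(1) v(1))
    finally show ?thesis .
  qed
  have "((\<lambda>r. I u r / r ^ CARD('n)) \<longlongrightarrow> 0) (at_right 0)" "((\<lambda>r. I v r / r ^ CARD('n)) \<longlongrightarrow> 0) (at_right 0)"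
    using u(2) v(2) unfolding has_trace_at_def I_def by simp_all
  from tendsto_add[OF this]
  have lim: "((\<lambda>r. I u r / r ^ CARD('n) + I v r / r ^ CARD('n)) \<longlongrightarrow> 0) (at_right 0)" by simp
  have nonneg: "0 \<le> I w r" for w r
    unfolding I_def set_lebesgue_integral_def by (intro Bochner_Integration.integral_nonneg) simp
  have "((\<lambda>r. I (\<lambda>y. (u y + v y) / 2) r / r ^ CARD('n)) \<longlongrightarrow> 0) (at_right 0)"
  proof (rule tendsto_sandwich[OF _ _ tendsto_const lim])
    have pos: "eventually (\<lambda>r. 0 < r) (at_right (0::real))" by (rule eventually_at_right_less)
    show "\<forall>\<^sub>F r in at_right 0. 0 \<le> I (\<lambda>y. (u y + v y) / 2) r / r ^ CARD('n)"
      using pos by eventually_elim (simp add: nonneg)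
    show "\<forall>\<^sub>F r in at_right 0. I (\<lambda>y. (u y + v y) / 2) r / r ^ CARD('n) \<le> I u r / r ^ CARD('n) + I v r / r ^ CARD('n)"
      using pos
    proof eventually_elim
      case (elim r)
      then show ?case
        unfolding add_divide_distrib[symmetric] using le[of r] by (intro divide_right_mono) auto
    qed
  qed
  then show ?thesis unfolding has_trace_at_def I_def by simp
qed

lemma zero_mem_constraint_set:
  assumes "open \<Omega>" "nonneg_borel_measure \<Omega> \<alpha>"
  shows "(\<lambda>_. 0) \<in> constraint_set p \<Omega> \<Gamma>D \<alpha>"
proof -
  have "hausdorff_measure (CARD('b) - 1) ({} :: (real^'b) set) = 0"
    using hausdorff_measure_0_countable_UN[of "{}" "CARD('b) - 1" "\<lambda>_. {}"] by simp
  then show ?thesis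
    unfolding mem_constraint_set_iff[OF assms]
    by (auto simp: dominated_variation_def has_trace_at_def intro!: exI[of _ "{}"])
qed

lemma midpoint_mem_constraint_set:
  fixes \<Omega> :: "(real^'n) set"
  assumes \<Omega>: "open \<Omega>" and \<alpha>: "nonneg_borel_measure \<Omega> \<alpha>"
    and "u \<in> constraint_set p \<Omega> \<Gamma>D \<alpha>" "v \<in> constraint_set p \<Omega> \<Gamma>D \<alpha>"
  shows "(\<lambda>x. (u x + v x) / 2) \<in> constraint_set p \<Omega> \<Gamma>D \<alpha>"
proof -
  obtain N N' where u: "integrable (lebesgue_on \<Omega>) u" "dominated_variation p \<Omega> \<alpha> u"
      "hausdorff_measure (CARD('n) - 1) N = 0" "\<forall>x\<in>\<Gamma>D - N. has_trace_at \<Omega> u x 0"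
    and v: "integrable (lebesgue_on \<Omega>) v" "dominated_variation p \<Omega> \<alpha> v"
      "hausdorff_measure (CARD('n) - 1) N' = 0" "\<forall>x\<in>\<Gamma>D - N'. has_trace_at \<Omega> v x 0"
    using assms(3,4) unfolding mem_constraint_set_iff[OF \<Omega> \<alpha>] by blast
  have "hausdorff_measure (CARD('n) - 1) (\<Union>A\<in>{N, N'}. A) = 0"
    using u(3) v(3) by (intro hausdorff_measure_0_countable_UN) auto
  then have "hausdorff_measure (CARD('n) - 1) (N \<union> N') = 0" by simp
  moreover have "\<forall>x\<in>\<Gamma>D - (N \<union> N'). has_trace_at \<Omega> (\<lambda>x. (u x + v x) / 2) x 0"
    using u(4) v(4) by (auto intro!: has_trace_at_midpoint \<Omega> u(1) v(1))
  moreover have "dominated_variation p \<Omega> \<alpha> (\<lambda>x. (u x + v x) / 2)"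
    by (rule dominated_variation_midpoint[OF \<Omega> u(1,2) v(1,2)])
  ultimately show ?thesis
    unfolding mem_constraint_set_iff[OF \<Omega> \<alpha>] using u(1) v(1) by auto
qed

text \<open>The variation bound for the limit comes first, because the trace argument needs the
  variation of \<open>u - s n\<close> to be dominated, hence that of \<open>u\<close> as
  well.\<close>

lemma constraint_set_L1_closed:
  fixes \<Omega> :: "(real^'n) set"
  assumes dom: "bounded_lipschitz_domain \<Omega>" and D: "\<Gamma>D \<subseteq> frontier \<Omega>"
    and \<alpha>: "nonneg_borel_measure \<Omega> \<alpha>"
    and s: "\<And>n. s n \<in> constraint_set p \<Omega> \<Gamma>D \<alpha>"
    and u: "integrable (lebesgue_on \<Omega>) u"
    and lim: "(\<lambda>n. LINT x|lebesgue_on \<Omega>. \<bar>u x - s n x\<bar>) \<longlonglongrightarrow> 0"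
  shows "u \<in> constraint_set p \<Omega> \<Gamma>D \<alpha>"
proof -
  have \<Omega>: "open \<Omega>" using dom by (simp add: bounded_lipschitz_domain_def)
  have s': "\<And>n. integrable (lebesgue_on \<Omega>) (s n)" "\<And>n. dominated_variation p \<Omega> \<alpha> (s n)"
      "\<And>n. \<exists>N. hausdorff_measure (CARD('n) - 1) N = 0 \<and> (\<forall>x\<in>\<Gamma>D - N. has_trace_at \<Omega> (s n) x 0)"
    using s unfolding mem_constraint_set_iff[OF \<Omega> \<alpha>] by auto
  have dv: "dominated_variation p \<Omega> \<alpha> u"
    by (rule dominated_variation_limit[OF \<Omega> u s'(1,2) lim])
  let ?E = "zero_extension \<Omega>"
  have int: "integrable lebesgue (?E v)" if "integrable (lebesgue_on \<Omega>) v" for v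
    unfolding zero_extension_def[abs_def] using that \<Omega> by (simp add: integrable_restrict_space)
  \<comment> \<open>In the constant \<open>c\<close>, \<open>u\<close> and \<open>s n\<close>
    contribute CARD('n) each, the price of passing to Euclidean fields.\<close>
  have "\<exists>N. hausdorff_measure (CARD('n) - 1) N = 0 \<and> (\<forall>x\<in>\<Gamma>D - N. has_trace_at \<Omega> (?E u) x 0)"
  proof (rule zero_trace_limit[OF dom int[OF u] int[OF s'(1)] \<alpha>, where c = "2 * real CARD('n)"])
    fix n V and W :: "real^'n \<Rightarrow> real^'n"
    assume V: "open V" "V \<subseteq> \<Omega>" and W: "W \<in> C1_compact_support V" "\<And>x. norm (W x) \<le> 1"
    have "(LINT x:V|lebesgue. (?E u x - ?E (s n) x) * divergence W x)
        = (LINT x:V|lebesgue. u x * divergence W x - s n x * divergence W x)"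
      unfolding set_lebesgue_integral_def zero_extension_def using V(2)
      by (intro Bochner_Integration.integral_cong refl) (auto simp: indicator_def algebra_simps)
    also have "\<dots> = (LINT x:V|lebesgue. u x * divergence W x) - (LINT x:V|lebesgue. s n x * divergence W x)"
      by (intro set_integral_diff integrable_mult_divergence[OF \<Omega> _ V W(1)] u s')
    finally have eq: "(LINT x:V|lebesgue. (?E u x - ?E (s n) x) * divergence W x)
        = (LINT x:V|lebesgue. u x * divergence W x) - (LINT x:V|lebesgue. s n x * divergence W x)" .
    have "(LINT x:V|lebesgue. u x * divergence W x) \<le> real CARD('n) * 1 * measure \<alpha> V"
      by (rule dominated_variation_scaled[OF dv V W]) simp
    \<comment> \<open>The lower bound for \<open>s n\<close> is the upper bound tested with
      \<open>- W\<close>.\<close>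
    moreover have "- (LINT x:V|lebesgue. s n x * divergence W x) \<le> real CARD('n) * 1 * measure \<alpha> V"
    proof -
      have "(LINT x:V|lebesgue. s n x * divergence (\<lambda>x. (- 1) *\<^sub>R W x) x) \<le> real CARD('n) * 1 * measure \<alpha> V"
        by (rule dominated_variation_scaled[OF s'(2) V C1_compact_support_scaleR(1)[OF W(1)]]) (use W(2) in auto)
      moreover have "(LINT x:V|lebesgue. s n x * divergence (\<lambda>x. (- 1) *\<^sub>R W x) x)
          = (LINT x:V|lebesgue. (- 1) * (s n x * divergence W x))"
        unfolding C1_compact_support_scaleR(2)[OF W(1)] by (simp only: mult.left_commute)
      ultimately show ?thesis unfolding set_integral_mult_right by simp
    qed
    ultimately show "(LINT x:V|lebesgue. (?E u x - ?E (s n) x) * divergence W x) \<le> 2 * real CARD('n) * measure \<alpha> V"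
      unfolding eq by simp
  next
    have "(LINT x|lebesgue. \<bar>?E u x - ?E (s n) x\<bar>) = (LINT x|lebesgue_on \<Omega>. \<bar>u x - s n x\<bar>)" for n
    proof -
      have "(LINT x|lebesgue_on \<Omega>. \<bar>u x - s n x\<bar>) = (LINT x|lebesgue. indicat_real \<Omega> x *\<^sub>R \<bar>u x - s n x\<bar>)"
        using \<Omega> by (subst integral_restrict_space) auto
      then show ?thesis
        unfolding zero_extension_def
        by (auto intro!: Bochner_Integration.integral_cong simp: indicator_def)
    qed
    then show "(\<lambda>n. LINT x|lebesgue. \<bar>?E u x - ?E (s n) x\<bar>) \<longlonglongrightarrow> 0" using lim by simp
  qed (use D s'(3) in \<open>auto simp: has_trace_at_zero_extension\<close>)
  then show ?thesis
    unfolding mem_constraint_set_iff[OF \<Omega> \<alpha>] using u dv by (simp add: has_trace_at_zero_extension)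
qed

section \<open>The minimization problem\<close>

lemma objective_eq_square_distance:
  assumes u: "u \<in> L2 \<Omega>" and f: "f \<in> L2 \<Omega>"
  shows "objective \<Omega> f u = ereal (1/2 * (LINT x|lebesgue_on \<Omega>. (u x - f x)\<^sup>2)
      - 1/2 * (LINT x|lebesgue_on \<Omega>. (f x)\<^sup>2))"
proof -
  have u': "u \<in> borel_measurable (lebesgue_on \<Omega>)" "integrable (lebesgue_on \<Omega>) (\<lambda>x. (u x)\<^sup>2)"
    and f': "f \<in> borel_measurable (lebesgue_on \<Omega>)" "integrable (lebesgue_on \<Omega>) (\<lambda>x. (f x)\<^sup>2)"
    using u f by (auto simp: L2_def)
  have d: "integrable (lebesgue_on \<Omega>) (\<lambda>x. (u x - f x)\<^sup>2)"
    by (rule integrable_square_diff[OF u'(1) f'(1) u'(2) f'(2)])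
  \<comment> \<open>Completing the square: writing the product through squares reduces its integral
    to integrals already known to exist.\<close>
  have "(LINT x|lebesgue_on \<Omega>. f x * u x)
      = (LINT x|lebesgue_on \<Omega>. (u x)\<^sup>2 / 2 + (f x)\<^sup>2 / 2 - (u x - f x)\<^sup>2 / 2)"
    by (intro Bochner_Integration.integral_cong) (auto simp: power2_eq_square field_simps)
  also have "\<dots> = (LINT x|lebesgue_on \<Omega>. (u x)\<^sup>2) / 2 + (LINT x|lebesgue_on \<Omega>. (f x)\<^sup>2) / 2
      - (LINT x|lebesgue_on \<Omega>. (u x - f x)\<^sup>2) / 2"
    using u'(2) f'(2) d by simp
  finally show ?thesis using u by (simp add: objective_def)
qed

theorem theorem3p2:
  fixes \<Omega> \<Gamma>D \<Gamma>N :: "(real^'n) set"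
    and p :: ennreal
    and f :: "real^'n \<Rightarrow> real"
    and \<alpha> :: "(real^'n) measure"
  assumes "bounded_lipschitz_domain \<Omega>"
    and "boundary_partition \<Omega> \<Gamma>D \<Gamma>N"
    and "1 \<le> p"
    and "f \<in> L2 \<Omega>"
    and "nonneg_borel_measure \<Omega> \<alpha>"
  shows "\<exists>u. is_solution p \<Omega> \<Gamma>D f \<alpha> u \<and>
           (\<forall>u'. is_solution p \<Omega> \<Gamma>D f \<alpha> u' \<longrightarrow> (AE x in lebesgue_on \<Omega>. u' x = u x))"
proof -
  note dom = assms(1) and f = assms(4) and \<alpha> = assms(5)
  have \<Omega>: "open \<Omega>" and "bounded \<Omega>" using dom by (auto simp: bounded_lipschitz_domain_def)
  have D: "\<Gamma>D \<subseteq> frontier \<Omega>" using assms(2) by (simp add: boundary_partition_def)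
  interpret finite_measure "lebesgue_on \<Omega>"
    using \<Omega> \<open>bounded \<Omega>\<close> by (intro finite_measure_lebesgue_on lmeasurable_open)
  let ?C = "constraint_set p \<Omega> \<Gamma>D \<alpha>"
  \<comment> \<open>Minimization is restricted to functions with finite objective; \<open>K\<close>
    is nonempty since it contains 0.\<close>
  define K where "K = ?C \<inter> L2 \<Omega>"
  define d where "d u = (LINT x|lebesgue_on \<Omega>. (u x - f x)\<^sup>2)" for u
  have f': "f \<in> borel_measurable (lebesgue_on \<Omega>)" "integrable (lebesgue_on \<Omega>) (\<lambda>x. (f x)\<^sup>2)"
    using f by (auto simp: L2_def)
  have K: "u \<in> borel_measurable (lebesgue_on \<Omega>)" "integrable (lebesgue_on \<Omega>) (\<lambda>x. (u x)\<^sup>2)" if "u \<in> K" for u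
    using that by (auto simp: K_def L2_def)
  have zero: "(\<lambda>_. 0) \<in> K"
    using zero_mem_constraint_set[OF \<Omega> \<alpha>] by (simp add: K_def L2_def)
  have mid: "(\<lambda>x. (u x + v x) / 2) \<in> K" if "u \<in> K" "v \<in> K" for u v
  proof -
    have "(\<lambda>x. ((u x + v x) / 2)\<^sup>2) = (\<lambda>x. (u x / 2 - (- v x / 2))\<^sup>2)"
      by (simp add: add_divide_distrib)
    moreover have "integrable (lebesgue_on \<Omega>) (\<lambda>x. (u x / 2 - (- v x / 2))\<^sup>2)"
      using K that by (intro integrable_square_diff) (auto simp: power_divide)
    ultimately have "integrable (lebesgue_on \<Omega>) (\<lambda>x. ((u x + v x) / 2)\<^sup>2)" by (simp only:)
    then have "(\<lambda>x. (u x + v x) / 2) \<in> L2 \<Omega>"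
      using K(1)[OF that(1)] K(1)[OF that(2)] unfolding L2_def mem_Collect_eq
      by (intro conjI borel_measurable_divide borel_measurable_add) simp_all
    then show ?thesis
      using that midpoint_mem_constraint_set[OF \<Omega> \<alpha>] by (simp add: K_def)
  qed
  have closed: "u \<in> K" if "\<And>n. s n \<in> K" "u \<in> borel_measurable (lebesgue_on \<Omega>)"
      "integrable (lebesgue_on \<Omega>) (\<lambda>x. (u x)\<^sup>2)" "(\<lambda>n. LINT x|lebesgue_on \<Omega>. \<bar>u x - s n x\<bar>) \<longlonglongrightarrow> 0" for s u
  proof -
    have "u \<in> ?C"
      by (rule constraint_set_L1_closed[OF dom D \<alpha> _ integrable_of_square[OF that(2,3)] that(4)])
         (use that(1) in \<open>simp add: K_def\<close>)
    then show ?thesis using that by (simp add: K_def L2_def)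
  qed
  have "\<exists>u\<in>K. \<forall>v\<in>K. d u \<le> d v"
  proof (rule nearest_point_exists[OF f', of K])
    show "u \<in> K" if "\<And>n. s n \<in> K" "u \<in> borel_measurable (lebesgue_on \<Omega>)"
      "integrable (lebesgue_on \<Omega>) (\<lambda>x. (u x)\<^sup>2)" "(\<lambda>n. LINT x|lebesgue_on \<Omega>. \<bar>u x - s n x\<bar>) \<longlonglongrightarrow> 0" for s u
      using that by (rule closed)
    show "\<exists>u\<in>K. \<forall>v\<in>K. d u \<le> d v" if "u \<in> K"
      "\<And>v. v \<in> K \<Longrightarrow> (LINT x|lebesgue_on \<Omega>. (u x - f x)\<^sup>2) \<le> (LINT x|lebesgue_on \<Omega>. (v x - f x)\<^sup>2)" for u
      using that unfolding d_def by blast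
  qed (fact K mid | use zero in blast)+
  then obtain u where u: "u \<in> K" "\<And>v. v \<in> K \<Longrightarrow> d u \<le> d v" by blast
  \<comment> \<open>On \<open>L2 \<Omega>\<close> the objective is an increasing affine function of
    \<open>d\<close>, so minimizers and nearest points to \<open>f\<close> coincide.\<close>
  have obj: "objective \<Omega> f v = ereal (1/2 * d v - 1/2 * (LINT x|lebesgue_on \<Omega>. (f x)\<^sup>2))" if "v \<in> L2 \<Omega>" for v
    unfolding d_def by (rule objective_eq_square_distance[OF that f])
  have obj_top: "objective \<Omega> f v = \<infinity>" if "v \<notin> L2 \<Omega>" for v
    using that by (simp add: objective_def)
  have uK: "u \<in> ?C" "u \<in> L2 \<Omega>" using u(1) by (auto simp: K_def)
  have "\<not> objective \<Omega> f v < objective \<Omega> f u" if "v \<in> ?C" for v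
  proof (cases "v \<in> L2 \<Omega>")
    case True
    then have "d u \<le> d v" using that u(2) by (simp add: K_def)
    then show ?thesis using obj[OF True] obj[OF uK(2)] by simp
  qed (simp add: obj_top)
  then have "is_solution p \<Omega> \<Gamma>D f \<alpha> u"
    unfolding is_solution_def is_arg_min_def using uK(1) by blast
  moreover have "AE x in lebesgue_on \<Omega>. u' x = u x" if "is_solution p \<Omega> \<Gamma>D f \<alpha> u'" for u'
  proof -
    have u': "u' \<in> ?C" "\<And>v. v \<in> ?C \<Longrightarrow> \<not> objective \<Omega> f v < objective \<Omega> f u'"
      using that unfolding is_solution_def is_arg_min_def by blast+
    \<comment> \<open>Otherwise the objective is infinite at \<open>u'\<close> but finite at
      \<open>u\<close>.\<close>
    have "u' \<in> L2 \<Omega>"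
    proof (rule ccontr)
      assume "u' \<notin> L2 \<Omega>"
      then show False using u'(2)[OF uK(1)] obj[OF uK(2)] obj_top by simp
    qed
    then have "u' \<in> K" using u'(1) by (simp add: K_def)
    \<comment> \<open>Both solutions are compared with their common midpoint, a competitor in
      \<open>K\<close>.\<close>
    let ?m = "\<lambda>x. (u' x + u x) / 2"
    have m: "?m \<in> K" using \<open>u' \<in> K\<close> u(1) by (rule mid)
    then have m': "?m \<in> ?C" "?m \<in> L2 \<Omega>" by (auto simp: K_def)
    have "d u' \<le> d ?m" using u'(2)[OF m'(1)] obj[OF m'(2)] obj[OF \<open>u' \<in> L2 \<Omega>\<close>] by simp
    moreover have "d u \<le> d ?m" using u(2)[OF m] .
    ultimately show ?thesis
      unfolding d_def
      by (intro nearest_point_unique[OF K(1)[OF \<open>u' \<in> K\<close>] K(1)[OF u(1)] f'(1) K(2)[OF \<open>u' \<in> K\<close>] K(2)[OF u(1)] f'(2)])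
  qed
  ultimately show ?thesis by blast
qed

end
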